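(* Let $A$ be a polynomial ring (in an arbitrary set of variables) over a semi-perfect field, let $K=\mathrm{Frac}(A)$, and let $\mathcal{U}$ be an infinite set. Then $\mathbf{R}^{\flat}=K\otimes_A A[[[x_i]]]_{i\in\mathcal{U}}$ is a polynomial $K$-algebra.
   Context: A field $\mathbf{k}$ is semi-perfect if it has characteristic $0$, or if it has characteristic $p>0$ and $[\mathbf{k}:\mathbf{k}^p]<\infty$. Graded means graded by the non-negative integers. For a ring $A$ and an infinite set $\mathcal{U}$, $A[[[x_i]]]_{i\in\mathcal{U}}=\varprojlim A[x_i]_{i\in\mathcal{V}}$ is the inverse limit in the category of graded rings over finite subsets $\mathcal{V}\subset\mathcal{U}$ of the standard-graded polynomial rings (transition maps set the extra variables to $0$). It is a graded ring whose degree $d$ elements are uniquely the formal sums $\sum c_e x^e$ over multi-indices $e\colon\mathcal{U}\to\mathbf{N}$ of finite support with sum of values $d$, with arbitrary $c_e\in A$. A graded $K$-algebra $R$ with $R_0=K$ is a polynomial $K$-algebra if there is a (possibly infinite) set of homogeneous elements of positive degree that is algebraically independent over $K$ and generates $R$ as a $K$-algebra. *)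

theory Defs
  imports
    "HOL-Computational_Algebra.Computational_Algebra"
    "HOL-Library.Poly_Mapping"
    "HOL-Library.FSet"
begin

section \<open>Semi-perfect fields\<close>

text \<open>The condition \<open>[k : k\<^sup>p] < \<infinity>\<close> says that \<open>k\<close> is spanned by a finite set \<open>B\<close> as a vector space
  over its subfield \<open>k\<^sup>p = {y\<^sup>p | y \<in> k}\<close>.\<close>

definition semi_perfect :: "'k::field itself \<Rightarrow> bool" where
  "semi_perfect _ \<longleftrightarrow>
     CHAR('k) = 0 \<or>
     (CHAR('k) > 0 \<and>
      (\<exists>B :: 'k set. finite B \<and>
        (\<forall>x. \<exists>c. (\<forall>b\<in>B. c b \<in> range (\<lambda>y. y ^ CHAR('k))) \<and> x = (\<Sum>b\<in>B. c b * b))))"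


section \<open>Algebras, polynomials and algebraic independence\<close>

definition ring_homomorphism :: "('a::comm_ring_1 \<Rightarrow> 'b::comm_ring_1) \<Rightarrow> bool" where
  "ring_homomorphism f \<longleftrightarrow>
     f 1 = 1 \<and> (\<forall>x y. f (x + y) = f x + f y) \<and> (\<forall>x y. f (x * y) = f x * f y)"

text \<open>An algebra over \<open>'k\<close> is a commutative ring \<open>'r\<close> with a structure map \<open>\<iota> :: 'k \<Rightarrow> 'r\<close>.
  Polynomials in variables \<open>'v\<close> are elements of \<open>('v \<Rightarrow>\<^sub>0 nat) \<Rightarrow>\<^sub>0 'k\<close>.\<close>

definition mono_degree :: "('v \<Rightarrow>\<^sub>0 nat) \<Rightarrow> nat" where
  "mono_degree m = (\<Sum>v\<in>Poly_Mapping.keys m. Poly_Mapping.lookup m v)"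

definition polys_in :: "'v set \<Rightarrow> (('v \<Rightarrow>\<^sub>0 nat) \<Rightarrow>\<^sub>0 'k::zero) set" where
  "polys_in V = {p. \<forall>m\<in>Poly_Mapping.keys p. Poly_Mapping.keys m \<subseteq> V}"

definition poly_eval ::
  "('k::comm_ring_1 \<Rightarrow> 'r::comm_ring_1) \<Rightarrow> ('v \<Rightarrow> 'r) \<Rightarrow> (('v \<Rightarrow>\<^sub>0 nat) \<Rightarrow>\<^sub>0 'k) \<Rightarrow> 'r" where
  "poly_eval \<iota> x p =
     (\<Sum>m\<in>Poly_Mapping.keys p. \<iota> (Poly_Mapping.lookup p m) *
        (\<Prod>v\<in>Poly_Mapping.keys m. x v ^ Poly_Mapping.lookup m v))"

text \<open>In the next definition the elements of \<open>X\<close> themselves serve as names of the variables.\<close>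

definition alg_independent :: "('k::comm_ring_1 \<Rightarrow> 'r::comm_ring_1) \<Rightarrow> 'r set \<Rightarrow> bool" where
  "alg_independent \<iota> X \<longleftrightarrow> (\<forall>p\<in>polys_in X. poly_eval \<iota> (\<lambda>x. x) p = 0 \<longrightarrow> p = 0)"

definition subalgebra :: "('k::comm_ring_1 \<Rightarrow> 'r::comm_ring_1) \<Rightarrow> 'r set \<Rightarrow> bool" where
  "subalgebra \<iota> S \<longleftrightarrow> range \<iota> \<subseteq> S \<and> (\<forall>x\<in>S. \<forall>y\<in>S. x + y \<in> S) \<and> (\<forall>x\<in>S. \<forall>y\<in>S. x * y \<in> S)"

definition generates_algebra :: "('k::comm_ring_1 \<Rightarrow> 'r::comm_ring_1) \<Rightarrow> 'r set \<Rightarrow> bool" where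
  "generates_algebra \<iota> X \<longleftrightarrow> subalgebra \<iota> hull X = UNIV"

text \<open>The ring \<open>'a\<close> is, via \<open>\<iota>\<close>, a polynomial ring over \<open>'k\<close> in the (possibly empty or infinite) set
  of variables \<open>T\<close>.\<close>

definition polynomial_ring_over :: "('k::comm_ring_1 \<Rightarrow> 'a::comm_ring_1) \<Rightarrow> 'a set \<Rightarrow> bool" where
  "polynomial_ring_over \<iota> T \<longleftrightarrow>
     ring_homomorphism \<iota> \<and> alg_independent \<iota> T \<and> generates_algebra \<iota> T"


section \<open>Graded polynomial algebras\<close>

definition add_subgroup :: "'r::ab_group_add set \<Rightarrow> bool" where
  "add_subgroup S \<longleftrightarrow> 0 \<in> S \<and> (\<forall>x\<in>S. \<forall>y\<in>S. x + y \<in> S) \<and> (\<forall>x\<in>S. - x \<in> S)"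

text \<open>\<open>R d\<close> is the degree \<open>d\<close> piece; the last conjunct says that the ring is the direct sum of its
  pieces.\<close>

definition ring_grading :: "(nat \<Rightarrow> 'r::comm_ring_1 set) \<Rightarrow> bool" where
  "ring_grading R \<longleftrightarrow>
     (\<forall>d. add_subgroup (R d)) \<and>
     1 \<in> R 0 \<and>
     (\<forall>i j. \<forall>x\<in>R i. \<forall>y\<in>R j. x * y \<in> R (i + j)) \<and>
     (\<forall>x. \<exists>!f. finite {d. f d \<noteq> 0} \<and> (\<forall>d. f d \<in> R d) \<and> x = (\<Sum>d | f d \<noteq> 0. f d))"

text \<open>The condition \<open>bij_betw \<iota> UNIV (R 0)\<close> is the requirement \<open>R\<^sub>0 = K\<close>.\<close>

definition polynomial_graded_algebra ::
  "('k::field \<Rightarrow> 'r::comm_ring_1) \<Rightarrow> (nat \<Rightarrow> 'r set) \<Rightarrow> bool" where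
  "polynomial_graded_algebra \<iota> R \<longleftrightarrow>
     ring_homomorphism \<iota> \<and> ring_grading R \<and> bij_betw \<iota> UNIV (R 0) \<and>
     (\<exists>X. (\<forall>x\<in>X. \<exists>d>0. x \<in> R d) \<and> alg_independent \<iota> X \<and> generates_algebra \<iota> X)"


section \<open>The inverse limit of polynomial rings\<close>

lemma keys_add_nat: "Poly_Mapping.keys (m + n) = Poly_Mapping.keys m \<union> Poly_Mapping.keys n"
  for m n :: "'v \<Rightarrow>\<^sub>0 nat"
  by (auto simp: in_keys_iff lookup_add)

lemma mono_degree_superset:
  "finite V \<Longrightarrow> Poly_Mapping.keys m \<subseteq> V \<Longrightarrow> mono_degree m = (\<Sum>v\<in>V. Poly_Mapping.lookup m v)"
  unfolding mono_degree_def by (rule sum.mono_neutral_left) (auto simp: in_keys_iff)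

lemma mono_degree_add: "mono_degree (m + n) = mono_degree m + mono_degree n"
  using mono_degree_superset[of "Poly_Mapping.keys m \<union> Poly_Mapping.keys n" m]
    mono_degree_superset[of "Poly_Mapping.keys m \<union> Poly_Mapping.keys n" n]
    mono_degree_superset[of "Poly_Mapping.keys m \<union> Poly_Mapping.keys n" "m + n"]
  by (simp add: keys_add_nat lookup_add sum.distrib)

lemma mono_degree_0 [simp]: "mono_degree 0 = 0"
  by (simp add: mono_degree_def)

text \<open>The transition map: set all variables outside \<open>V\<close> to \<open>0\<close>.\<close>

lift_definition kill_vars ::
  "'v set \<Rightarrow> (('v \<Rightarrow>\<^sub>0 nat) \<Rightarrow>\<^sub>0 'k::zero) \<Rightarrow> (('v \<Rightarrow>\<^sub>0 nat) \<Rightarrow>\<^sub>0 'k)"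
  is "\<lambda>V p m. p m when Poly_Mapping.keys m \<subseteq> V"
  by (auto elim: rev_finite_subset)

lemma lookup_kill_vars:
  "Poly_Mapping.lookup (kill_vars V p) m = (Poly_Mapping.lookup p m when Poly_Mapping.keys m \<subseteq> V)"
  by transfer simp

lemma kill_vars_0: "kill_vars V 0 = 0"
  by (rule poly_mapping_eqI) (simp add: lookup_kill_vars)

lemma kill_vars_1: "kill_vars V 1 = 1"
  by (rule poly_mapping_eqI) (simp add: lookup_kill_vars lookup_one when_def)

lemma kill_vars_add: "kill_vars V (p + q) = kill_vars V p + kill_vars V q"
  for p q :: "('v \<Rightarrow>\<^sub>0 nat) \<Rightarrow>\<^sub>0 'k::comm_monoid_add"
  by (rule poly_mapping_eqI) (simp add: lookup_kill_vars lookup_add when_def)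

lemma kill_vars_uminus: "kill_vars V (- p) = - kill_vars V p"
  for p :: "('v \<Rightarrow>\<^sub>0 nat) \<Rightarrow>\<^sub>0 'k::ab_group_add"
  by (rule poly_mapping_eqI) (simp add: lookup_kill_vars when_def)

lemma kill_vars_mult: "kill_vars V (p * q) = kill_vars V p * kill_vars V q"
  for p q :: "('v \<Rightarrow>\<^sub>0 nat) \<Rightarrow>\<^sub>0 'k::comm_semiring_0"
proof (rule poly_mapping_eqI)
  fix m
  let ?p = "kill_vars V p" and ?q = "kill_vars V q"
  have *: "Poly_Mapping.lookup ?p l * Sum_any (\<lambda>r. Poly_Mapping.lookup ?q r when m = l + r) =
      (Poly_Mapping.lookup p l * Sum_any (\<lambda>r. Poly_Mapping.lookup q r when m = l + r)
         when Poly_Mapping.keys m \<subseteq> V)" for l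
  proof (cases "Poly_Mapping.keys l \<subseteq> V")
    case True
    have "(\<lambda>r. Poly_Mapping.lookup ?q r when m = l + r) =
        (\<lambda>r. (Poly_Mapping.lookup q r when m = l + r) when Poly_Mapping.keys m \<subseteq> V)"
      using True by (intro ext) (auto simp: lookup_kill_vars when_def keys_add_nat)
    note eq = this
    show ?thesis unfolding eq
      using True by (cases "Poly_Mapping.keys m \<subseteq> V") (simp_all add: lookup_kill_vars)
  next
    case False
    have "Sum_any (\<lambda>r. Poly_Mapping.lookup q r when m = l + r) = 0" if "Poly_Mapping.keys m \<subseteq> V"
    proof -
      have "m \<noteq> l + r" for r using False that by (auto simp: keys_add_nat)
      thus ?thesis by simp
    qed
    thus ?thesis using False
      by (cases "Poly_Mapping.keys m \<subseteq> V") (simp_all add: lookup_kill_vars)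
  qed
  show "Poly_Mapping.lookup (kill_vars V (p * q)) m = Poly_Mapping.lookup (?p * ?q) m"
    by (cases "Poly_Mapping.keys m \<subseteq> V") (simp_all add: lookup_kill_vars[of V "p * q"] lookup_mult *)
qed

lemma polys_in_0: "0 \<in> polys_in V"
  by (simp add: polys_in_def)

lemma polys_in_1: "1 \<in> polys_in V"
  by (auto simp: polys_in_def in_keys_iff lookup_one when_def split: if_splits)

lemma polys_in_add: "p \<in> polys_in V \<Longrightarrow> q \<in> polys_in V \<Longrightarrow> p + q \<in> polys_in V"
  using Poly_Mapping.keys_add[of p q] by (fastforce simp: polys_in_def)

lemma polys_in_uminus: "p \<in> polys_in V \<Longrightarrow> - p \<in> polys_in V"
  for p :: "('v \<Rightarrow>\<^sub>0 nat) \<Rightarrow>\<^sub>0 'k::ab_group_add"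
  by (simp add: polys_in_def in_keys_iff)

lemma polys_in_mult: "p \<in> polys_in V \<Longrightarrow> q \<in> polys_in V \<Longrightarrow> p * q \<in> polys_in V"
  for p q :: "('v \<Rightarrow>\<^sub>0 nat) \<Rightarrow>\<^sub>0 'k::comm_semiring_0"
  using keys_mult[of p q] by (fastforce simp: polys_in_def keys_add_nat)

text \<open>The ring \<open>A[[[x\<^sub>i]]]\<close> for \<open>i\<close> ranging over the type \<open>'u\<close>.  Its elements are the families of
  polynomials \<open>F V \<in> A[x\<^sub>i]\<^bsub>i\<in>V\<^esub>\<close>, \<open>V\<close> a finite set of variables, that are compatible with the
  transition maps and have bounded degree.  Boundedness is what distinguishes the limit of graded
  rings, which is the direct sum over \<open>d\<close> of the limits of the degree \<open>d\<close> pieces, from the limit of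
  rings.\<close>

typedef (overloaded) ('u, 'a) graded_lim =
  "{F :: 'u fset \<Rightarrow> (('u \<Rightarrow>\<^sub>0 nat) \<Rightarrow>\<^sub>0 'a::comm_ring_1).
     (\<forall>V. F V \<in> polys_in (fset V)) \<and>
     (\<forall>V W. V |\<subseteq>| W \<longrightarrow> kill_vars (fset V) (F W) = F V) \<and>
     (\<exists>d. \<forall>V. \<forall>m\<in>Poly_Mapping.keys (F V). mono_degree m \<le> d)}"
  morphisms component Abs_graded_lim
  by (rule exI[of _ "\<lambda>_. 0"]) (simp add: polys_in_0 kill_vars_0)

setup_lifting type_definition_graded_lim

instantiation graded_lim :: (type, comm_ring_1) comm_ring_1
begin

lift_definition zero_graded_lim :: "('a, 'b) graded_lim" is "\<lambda>_. 0"
  by (simp add: polys_in_0 kill_vars_0)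

lift_definition one_graded_lim :: "('a, 'b) graded_lim" is "\<lambda>_. 1"
  by (auto simp: polys_in_1 kill_vars_1 in_keys_iff lookup_one when_def)

lift_definition plus_graded_lim ::
  "('a, 'b) graded_lim \<Rightarrow> ('a, 'b) graded_lim \<Rightarrow> ('a, 'b) graded_lim" is "\<lambda>F G V. F V + G V"
proof (intro CollectI conjI; elim CollectE conjE exE)
  fix F G :: "'a fset \<Rightarrow> (('a \<Rightarrow>\<^sub>0 nat) \<Rightarrow>\<^sub>0 'b)" and d e
  assume d: "\<forall>V. \<forall>m\<in>Poly_Mapping.keys (F V). mono_degree m \<le> d"
    and e: "\<forall>V. \<forall>m\<in>Poly_Mapping.keys (G V). mono_degree m \<le> e"
  have "mono_degree m \<le> d + e" if "m \<in> Poly_Mapping.keys (F V + G V)" for V m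
    using d e that Poly_Mapping.keys_add[of "F V" "G V"] by (meson UnE subsetD trans_le_add1 trans_le_add2)
  thus "\<exists>d. \<forall>V. \<forall>m\<in>Poly_Mapping.keys (F V + G V). mono_degree m \<le> d" by blast
qed (simp_all add: polys_in_add kill_vars_add)

lift_definition uminus_graded_lim :: "('a, 'b) graded_lim \<Rightarrow> ('a, 'b) graded_lim" is "\<lambda>F V. - F V"
  by (simp add: polys_in_uminus kill_vars_uminus in_keys_iff)

definition minus_graded_lim ::
  "('a, 'b) graded_lim \<Rightarrow> ('a, 'b) graded_lim \<Rightarrow> ('a, 'b) graded_lim" where
  "minus_graded_lim F G = F + - G"

lift_definition times_graded_lim ::
  "('a, 'b) graded_lim \<Rightarrow> ('a, 'b) graded_lim \<Rightarrow> ('a, 'b) graded_lim" is "\<lambda>F G V. F V * G V"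
proof (intro CollectI conjI; elim CollectE conjE exE)
  fix F G :: "'a fset \<Rightarrow> (('a \<Rightarrow>\<^sub>0 nat) \<Rightarrow>\<^sub>0 'b)" and d e
  assume d: "\<forall>V. \<forall>m\<in>Poly_Mapping.keys (F V). mono_degree m \<le> d"
    and e: "\<forall>V. \<forall>m\<in>Poly_Mapping.keys (G V). mono_degree m \<le> e"
  have "mono_degree m \<le> d + e" if "m \<in> Poly_Mapping.keys (F V * G V)" for V m
  proof -
    have "m \<in> {a + b | a b. a \<in> Poly_Mapping.keys (F V) \<and> b \<in> Poly_Mapping.keys (G V)}"
      using subsetD[OF keys_mult that] .
    then obtain a b where
      "m = a + b" "a \<in> Poly_Mapping.keys (F V)" "b \<in> Poly_Mapping.keys (G V)"
      by blast
    thus ?thesis using d e by (auto simp: mono_degree_add intro!: add_mono)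
  qed
  thus "\<exists>d. \<forall>V. \<forall>m\<in>Poly_Mapping.keys (F V * G V). mono_degree m \<le> d" by blast
qed (simp_all add: polys_in_mult kill_vars_mult)

instance
  by intro_classes
    (simp_all add: minus_graded_lim_def, (transfer, simp add: fun_eq_iff algebra_simps)+)

end

lift_definition graded_lim_const :: "'a::comm_ring_1 \<Rightarrow> ('u, 'a) graded_lim"
  is "\<lambda>a _. Poly_Mapping.single 0 a"
  by (auto simp: polys_in_def kill_vars_def lookup_single when_def
      intro!: poly_mapping_eqI exI[of _ 0] split: if_splits)

definition graded_lim_piece :: "nat \<Rightarrow> ('u, 'a::comm_ring_1) graded_lim set" where
  "graded_lim_piece d = {F. \<forall>V. \<forall>m\<in>Poly_Mapping.keys (component F V). mono_degree m = d}"


text \<open>The elements of degree \<open>d\<close> are uniquely the formal sums \<open>\<Sum> c\<^sub>m x\<^sup>m\<close> over the monomials \<open>m\<close> of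
  degree \<open>d\<close>, with arbitrary coefficients.\<close>

definition graded_lim_coeff :: "('u, 'a::comm_ring_1) graded_lim \<Rightarrow> ('u \<Rightarrow>\<^sub>0 nat) \<Rightarrow> 'a" where
  "graded_lim_coeff F m = Poly_Mapping.lookup (component F (Abs_fset (Poly_Mapping.keys m))) m"

lemma lookup_component:
  "Poly_Mapping.lookup (component F V) m = (graded_lim_coeff F m when Poly_Mapping.keys m \<subseteq> fset V)"
proof (cases "Poly_Mapping.keys m \<subseteq> fset V")
  case True
  define W where "W = Abs_fset (Poly_Mapping.keys m)"
  have W: "fset W = Poly_Mapping.keys m"
    by (simp add: W_def Abs_fset_inverse)
  hence "W |\<subseteq>| V" using True by (simp add: less_eq_fset.rep_eq)
  hence "kill_vars (fset W) (component F V) = component F W"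
    using component[of F] by blast
  from this[symmetric] have "Poly_Mapping.lookup (component F W) m = Poly_Mapping.lookup (component F V) m"
    by (simp add: lookup_kill_vars W)
  thus ?thesis using True by (simp add: graded_lim_coeff_def W_def)
next
  case False
  have "component F V \<in> polys_in (fset V)"
    using component[of F] by blast
  hence "m \<notin> Poly_Mapping.keys (component F V)"
    using False by (auto simp: polys_in_def)
  thus ?thesis using False by (simp add: in_keys_iff)
qed

lemma finite_monomials:
  assumes "finite V"
  shows "finite {m. Poly_Mapping.keys m \<subseteq> V \<and> mono_degree m \<le> d}"
proof (rule finite_subset)
  let ?S = "{f. \<forall>v. (v \<in> V \<longrightarrow> f v \<in> {..d}) \<and> (v \<notin> V \<longrightarrow> f v = (0::nat))}"
  have "Poly_Mapping.lookup m v \<le> d" if "Poly_Mapping.keys m \<subseteq> V" "mono_degree m \<le> d" for m v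
  proof (cases "v \<in> V")
    case True
    have "Poly_Mapping.lookup m v \<le> (\<Sum>v\<in>V. Poly_Mapping.lookup m v)"
      using True assms by (intro member_le_sum) auto
    thus ?thesis using that assms by (simp add: mono_degree_superset)
  next
    case False
    hence "v \<notin> Poly_Mapping.keys m" using that by blast
    thus ?thesis by (simp add: in_keys_iff)
  qed
  hence "Poly_Mapping.lookup m \<in> ?S" if "Poly_Mapping.keys m \<subseteq> V" "mono_degree m \<le> d" for m
    using that by (auto simp: in_keys_iff subset_iff)
  thus "{m. Poly_Mapping.keys m \<subseteq> V \<and> mono_degree m \<le> d} \<subseteq> Poly_Mapping.lookup -` ?S"
    by blast
  have "finite ?S" by (rule finite_set_of_finite_funs) (use assms in auto)
  thus "finite (Poly_Mapping.lookup -` ?S)"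
    by (rule finite_vimageI) (simp add: inj_def)
qed

lemma bij_betw_graded_lim_coeff:
  "bij_betw graded_lim_coeff (graded_lim_piece d)
     {c :: ('u \<Rightarrow>\<^sub>0 nat) \<Rightarrow> 'a::comm_ring_1. \<forall>m. c m \<noteq> 0 \<longrightarrow> mono_degree m = d}"
proof (rule bij_betwI')
  fix F G :: "('u, 'a) graded_lim"
  show "graded_lim_coeff F = graded_lim_coeff G \<longleftrightarrow> F = G"
  proof
    assume "graded_lim_coeff F = graded_lim_coeff G"
    hence "component F = component G"
      by (intro ext poly_mapping_eqI) (simp add: lookup_component)
    thus "F = G" by (simp add: component_inject)
  qed simp
next
  fix F :: "('u, 'a) graded_lim"
  assume "F \<in> graded_lim_piece d"
  thus "graded_lim_coeff F \<in> {c. \<forall>m. c m \<noteq> 0 \<longrightarrow> mono_degree m = d}"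
    by (auto simp: graded_lim_piece_def graded_lim_coeff_def in_keys_iff)
next
  fix c :: "('u \<Rightarrow>\<^sub>0 nat) \<Rightarrow> 'a"
  assume "c \<in> {c. \<forall>m. c m \<noteq> 0 \<longrightarrow> mono_degree m = d}"
  hence c: "mono_degree m = d" if "c m \<noteq> 0" for m using that by blast
  define F :: "'u fset \<Rightarrow> (('u \<Rightarrow>\<^sub>0 nat) \<Rightarrow>\<^sub>0 'a)" where
    "F V = Abs_poly_mapping (\<lambda>m. c m when Poly_Mapping.keys m \<subseteq> fset V)" for V
  have F: "Poly_Mapping.lookup (F V) m = (c m when Poly_Mapping.keys m \<subseteq> fset V)" for V m
  proof -
    have "finite {m. (c m when Poly_Mapping.keys m \<subseteq> fset V) \<noteq> 0}"
      by (rule finite_subset[OF _ finite_monomials[OF finite_fset[of V], of d]])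
        (auto simp: when_def c split: if_splits)
    thus ?thesis by (simp add: F_def)
  qed
  have "kill_vars (fset V) (F W) = F V" if "V |\<subseteq>| W" for V W
    using that by (intro poly_mapping_eqI) (auto simp: lookup_kill_vars F when_def less_eq_fset.rep_eq)
  moreover have "F V \<in> polys_in (fset V)" for V
    by (fastforce simp: polys_in_def in_keys_iff[of _ "F V"] F when_def split: if_splits)
  moreover have deg: "mono_degree m = d" if "m \<in> Poly_Mapping.keys (F V)" for m V
    using that c by (auto simp: in_keys_iff F)
  ultimately have comp: "component (Abs_graded_lim F) = F"
    by (intro Abs_graded_lim_inverse) (auto intro!: exI[of _ d])
  have "Abs_graded_lim F \<in> graded_lim_piece d"
    using deg by (auto simp: graded_lim_piece_def comp)
  moreover have "c = graded_lim_coeff (Abs_graded_lim F)"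
    by (rule ext) (simp add: graded_lim_coeff_def comp F Abs_fset_inverse)
  ultimately show "\<exists>F\<in>graded_lim_piece d. c = graded_lim_coeff F" by blast
qed


section \<open>Tensor products of commutative algebras\<close>

text \<open>The pure tensors form a commutative monoid under \<open>(b \<otimes> c)(b' \<otimes> c') = bb' \<otimes> cc'\<close>, written
  additively here so that \<open>('b, 'c) pure_tensor \<Rightarrow>\<^sub>0 int\<close>, the free abelian group on pairs, is its
  monoid ring.  The tensor product is the quotient of this group by the usual bilinearity
  relations, for structure maps \<open>\<phi>\<close> and \<open>\<psi>\<close> of the two algebras.\<close>

datatype ('b, 'c) pure_tensor = Pure_Tensor 'b 'c

instantiation pure_tensor :: (comm_monoid_mult, comm_monoid_mult) comm_monoid_add
begin

definition zero_pure_tensor :: "('a, 'b) pure_tensor" where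
  "zero_pure_tensor = Pure_Tensor 1 1"

fun plus_pure_tensor ::
  "('a, 'b) pure_tensor \<Rightarrow> ('a, 'b) pure_tensor \<Rightarrow> ('a, 'b) pure_tensor" where
  "plus_pure_tensor (Pure_Tensor b c) (Pure_Tensor b' c') = Pure_Tensor (b * b') (c * c')"

instance
proof
  fix x y z :: "('a, 'b) pure_tensor"
  show "x + y + z = x + (y + z)" by (cases x; cases y; cases z) (simp add: mult.assoc)
  show "x + y = y + x" by (cases x; cases y) (simp add: mult.commute)
  show "0 + x = x" by (cases x) (simp add: zero_pure_tensor_def)
qed

end

abbreviation free_tensor :: "'b \<Rightarrow> 'c \<Rightarrow> (('b, 'c) pure_tensor \<Rightarrow>\<^sub>0 int)" where
  "free_tensor b c \<equiv> Poly_Mapping.single (Pure_Tensor b c) 1"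

definition tensor_relations ::
  "('a \<Rightarrow> 'b::comm_ring_1) \<Rightarrow> ('a \<Rightarrow> 'c::comm_ring_1) \<Rightarrow> (('b, 'c) pure_tensor \<Rightarrow>\<^sub>0 int) set" where
  "tensor_relations \<phi> \<psi> =
     {free_tensor (b + b') c - free_tensor b c - free_tensor b' c | b b' c. True} \<union>
     {free_tensor b (c + c') - free_tensor b c - free_tensor b c' | b c c'. True} \<union>
     {free_tensor (\<phi> a * b) c - free_tensor b (\<psi> a * c) | a b c. True}"

definition tensor_null ::
  "('a \<Rightarrow> 'b::comm_ring_1) \<Rightarrow> ('a \<Rightarrow> 'c::comm_ring_1) \<Rightarrow> (('b, 'c) pure_tensor \<Rightarrow>\<^sub>0 int) set" where
  "tensor_null \<phi> \<psi> = add_subgroup hull tensor_relations \<phi> \<psi>"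

lemma add_subgroup_hull: "add_subgroup (add_subgroup hull S)"
  by (rule hull_in) (auto simp: add_subgroup_def)

lemma add_subgroup_diff: "add_subgroup S \<Longrightarrow> x \<in> S \<Longrightarrow> y \<in> S \<Longrightarrow> x - y \<in> S"
  by (metis add_subgroup_def diff_conv_add_uminus)

lemma add_subgroup_tensor_null: "add_subgroup (tensor_null \<phi> \<psi>)"
  by (simp add: tensor_null_def add_subgroup_hull)

lemma tensor_relations_mult:
  assumes "r \<in> tensor_relations \<phi> \<psi>"
  shows "free_tensor b c * r \<in> tensor_relations \<phi> \<psi>"
proof -
  consider (left) b1 b2 c1 where "r = free_tensor (b1 + b2) c1 - free_tensor b1 c1 - free_tensor b2 c1"
    | (right) b1 c1 c2 where "r = free_tensor b1 (c1 + c2) - free_tensor b1 c1 - free_tensor b1 c2"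
    | (scal) a b1 c1 where "r = free_tensor (\<phi> a * b1) c1 - free_tensor b1 (\<psi> a * c1)"
    using assms unfolding tensor_relations_def by blast
  thus ?thesis
  proof cases
    case left
    have "free_tensor b c * r = free_tensor (b * b1 + b * b2) (c * c1)
        - free_tensor (b * b1) (c * c1) - free_tensor (b * b2) (c * c1)"
      by (simp add: left right_diff_distrib mult_single distrib_left)
    thus ?thesis unfolding tensor_relations_def by blast
  next
    case right
    have "free_tensor b c * r = free_tensor (b * b1) (c * c1 + c * c2)
        - free_tensor (b * b1) (c * c1) - free_tensor (b * b1) (c * c2)"
      by (simp add: right right_diff_distrib mult_single distrib_left)
    thus ?thesis unfolding tensor_relations_def by blast
  next
    case scal
    have "free_tensor b c * r = free_tensor (\<phi> a * (b * b1)) (c * c1)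
        - free_tensor (b * b1) (\<psi> a * (c * c1))"
      by (simp add: scal right_diff_distrib mult_single mult.left_commute)
    thus ?thesis unfolding tensor_relations_def by blast
  qed
qed

lemma tensor_null_mult:
  assumes "q \<in> tensor_null \<phi> \<psi>"
  shows "p * q \<in> tensor_null \<phi> \<psi>"
proof -
  let ?N = "tensor_null \<phi> \<psi>"
  note N = add_subgroup_tensor_null[of \<phi> \<psi>]
  have rel: "tensor_relations \<phi> \<psi> \<subseteq> ?N"
    by (simp add: tensor_null_def hull_subset)
  have pure: "free_tensor b c * q \<in> ?N" for b c
  proof -
    have "add_subgroup {x. free_tensor b c * x \<in> ?N}"
      using N by (simp add: add_subgroup_def distrib_left)
    moreover have "tensor_relations \<phi> \<psi> \<subseteq> {x. free_tensor b c * x \<in> ?N}"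
      using tensor_relations_mult rel by blast
    ultimately have "?N \<subseteq> {x. free_tensor b c * x \<in> ?N}"
      unfolding tensor_null_def by (intro hull_minimal)
    thus ?thesis using assms by blast
  qed
  show ?thesis
  proof (rule frag_induction[where S = UNIV and P = "\<lambda>p. p * q \<in> ?N"])
    show "frag_of x * q \<in> ?N" for x
      using pure by (cases x) simp
  qed (use N in \<open>auto simp: add_subgroup_def left_diff_distrib intro: add_subgroup_diff\<close>)
qed

definition tensor_eq ::
  "('a \<Rightarrow> 'b::comm_ring_1) \<Rightarrow> ('a \<Rightarrow> 'c::comm_ring_1) \<Rightarrow>
     (('b, 'c) pure_tensor \<Rightarrow>\<^sub>0 int) \<Rightarrow> (('b, 'c) pure_tensor \<Rightarrow>\<^sub>0 int) \<Rightarrow> bool" where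
  "tensor_eq \<phi> \<psi> x y \<longleftrightarrow> x - y \<in> tensor_null \<phi> \<psi>"

lemma equivp_tensor_eq: "equivp (tensor_eq \<phi> \<psi>)"
proof (rule equivpI)
  note N = add_subgroup_tensor_null[of \<phi> \<psi>]
  show "reflp (tensor_eq \<phi> \<psi>)"
    using N by (simp add: reflp_def tensor_eq_def add_subgroup_def)
  show "symp (tensor_eq \<phi> \<psi>)"
    unfolding symp_def tensor_eq_def using N by (metis add_subgroup_def minus_diff_eq)
  show "transp (tensor_eq \<phi> \<psi>)"
  proof (rule transpI)
    fix x y z assume "tensor_eq \<phi> \<psi> x y" "tensor_eq \<phi> \<psi> y z"
    hence "(x - y) + (y - z) \<in> tensor_null \<phi> \<psi>"
      using N unfolding tensor_eq_def add_subgroup_def by blast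
    thus "tensor_eq \<phi> \<psi> x z" by (simp add: tensor_eq_def)
  qed
qed


section \<open>The ring \<open>K \<otimes>\<^sub>A A[[[x\<^sub>i]]]\<close> for \<open>K = Frac A\<close>\<close>

text \<open>Here \<open>A\<close> is the type \<open>'a\<close>, and the variables are indexed by the type \<open>'u\<close>.\<close>

abbreviation (input) rflat_eq where
  "rflat_eq \<equiv> tensor_eq to_fract graded_lim_const"

quotient_type (overloaded) ('u, 'a) rflat =
  "('a::idom fract, ('u, 'a) graded_lim) pure_tensor \<Rightarrow>\<^sub>0 int" /
  "tensor_eq to_fract graded_lim_const"
  by (rule equivp_tensor_eq)

text \<open>The constant coefficient gives a map to \<open>K\<close>, showing that the tensor product is not zero.\<close>

definition const_coeff :: "('u, 'a::comm_ring_1) graded_lim \<Rightarrow> 'a" where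
  "const_coeff F = Poly_Mapping.lookup (component F {||}) 0"

lemma const_coeff_simps:
  "const_coeff (F + G) = const_coeff F + const_coeff G"
  "const_coeff (graded_lim_const a * F) = a * const_coeff F"
  "const_coeff 1 = 1"
  by (simp_all add: const_coeff_def plus_graded_lim.rep_eq lookup_add times_graded_lim.rep_eq
      graded_lim_const.rep_eq one_graded_lim.rep_eq lookup_one
      flip: mult_map_scale_conv_mult) (simp add: Poly_Mapping.map.rep_eq when_def)

definition rflat_aug :: "(('a::idom fract, ('u, 'a) graded_lim) pure_tensor \<Rightarrow>\<^sub>0 int) \<Rightarrow> 'a fract" where
  "rflat_aug x = (\<Sum>t\<in>Poly_Mapping.keys x. of_int (Poly_Mapping.lookup x t) *
     (case t of Pure_Tensor b c \<Rightarrow> b * to_fract (const_coeff c)))"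

lemma rflat_aug_add: "rflat_aug (x + y) = rflat_aug x + rflat_aug y"
  unfolding rflat_aug_def by (rule setsum_keys_plus_distrib) (simp_all add: distrib_right)

lemma rflat_aug_uminus: "rflat_aug (- x) = - rflat_aug x"
  unfolding rflat_aug_def by (simp add: sum_negf keys_def)

lemma rflat_aug_diff: "rflat_aug (x - y) = rflat_aug x - rflat_aug y"
  by (metis diff_conv_add_uminus rflat_aug_add rflat_aug_uminus)

lemma rflat_aug_free: "rflat_aug (free_tensor b c) = b * to_fract (const_coeff c)"
  by (simp add: rflat_aug_def)

lemma rflat_aug_null:
  assumes "x \<in> tensor_null to_fract graded_lim_const"
  shows "rflat_aug x = 0"
proof -
  have "add_subgroup {x. rflat_aug x = 0}"
    by (auto simp: add_subgroup_def rflat_aug_add rflat_aug_uminus) (simp add: rflat_aug_def)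
  moreover have "tensor_relations to_fract graded_lim_const \<subseteq> {x. rflat_aug x = 0}"
    by (auto simp: tensor_relations_def rflat_aug_diff rflat_aug_free const_coeff_simps
        distrib_left distrib_right)
  ultimately have "tensor_null to_fract graded_lim_const \<subseteq> {x. rflat_aug x = 0}"
    unfolding tensor_null_def by (intro hull_minimal)
  thus ?thesis using assms by blast
qed

instantiation rflat :: (type, idom) comm_ring_1
begin

lift_definition zero_rflat :: "('a, 'b) rflat" is 0 .

lift_definition one_rflat :: "('a, 'b) rflat" is 1 .

lift_definition plus_rflat :: "('a, 'b) rflat \<Rightarrow> ('a, 'b) rflat \<Rightarrow> ('a, 'b) rflat" is "(+)"
  using add_subgroup_tensor_null[of to_fract graded_lim_const]
  unfolding tensor_eq_def add_subgroup_def add_diff_add by blast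

lift_definition uminus_rflat :: "('a, 'b) rflat \<Rightarrow> ('a, 'b) rflat" is uminus
  using add_subgroup_tensor_null[of to_fract graded_lim_const]
  unfolding tensor_eq_def add_subgroup_def by (metis minus_diff_minus)

definition minus_rflat :: "('a, 'b) rflat \<Rightarrow> ('a, 'b) rflat \<Rightarrow> ('a, 'b) rflat" where
  "minus_rflat x y = x + - y"

lift_definition times_rflat :: "('a, 'b) rflat \<Rightarrow> ('a, 'b) rflat \<Rightarrow> ('a, 'b) rflat" is "(*)"
proof -
  fix x x' y y' :: "('b fract, ('a, 'b) graded_lim) pure_tensor \<Rightarrow>\<^sub>0 int"
  let ?N = "tensor_null (to_fract :: 'b \<Rightarrow> _) (graded_lim_const :: 'b \<Rightarrow> ('a, 'b) graded_lim)"
  assume "rflat_eq x x'" "rflat_eq y y'"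
  hence "y * (x - x') \<in> ?N" "x' * (y - y') \<in> ?N"
    by (simp_all add: tensor_eq_def tensor_null_mult)
  hence "y * (x - x') + x' * (y - y') \<in> ?N"
    using add_subgroup_tensor_null by (auto simp: add_subgroup_def)
  also have "y * (x - x') + x' * (y - y') = x * y - x' * y'"
    by (simp add: algebra_simps)
  finally show "rflat_eq (x * y) (x' * y')"
    by (simp add: tensor_eq_def)
qed

instance
proof
  have refl: "rflat_eq x x" for x :: "('b fract, ('a, 'b) graded_lim) pure_tensor \<Rightarrow>\<^sub>0 int"
    using equivp_tensor_eq by (rule equivp_reflp)
  fix x y z :: "('a, 'b) rflat"
  show "x + y + z = x + (y + z)" by transfer (simp add: refl add.assoc)
  show "x + y = y + x" by transfer (simp add: refl add.commute)
  show "0 + x = x" by transfer (simp add: refl)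
  show "- x + x = 0" by transfer (simp add: refl)
  show "x - y = x + - y" by (simp add: minus_rflat_def)
  show "x * y * z = x * (y * z)" by transfer (simp add: refl mult.assoc)
  show "x * y = y * x" by transfer (simp add: refl mult.commute)
  show "1 * x = x" by transfer (simp add: refl)
  show "(x + y) * z = x * z + y * z" by transfer (simp add: refl distrib_right)
  show "(0 :: ('a, 'b) rflat) \<noteq> 1"
  proof transfer
    have "rflat_aug (0 - 1 :: ('b fract, ('a, 'b) graded_lim) pure_tensor \<Rightarrow>\<^sub>0 int) = - 1"
      by (simp add: rflat_aug_uminus zero_pure_tensor_def rflat_aug_free const_coeff_simps
          flip: single_one)
    thus "\<not> rflat_eq 0 (1 :: ('b fract, ('a, 'b) graded_lim) pure_tensor \<Rightarrow>\<^sub>0 int)"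
      using rflat_aug_null by (force simp: tensor_eq_def)
  qed
qed

end

definition tensor :: "'a::idom fract \<Rightarrow> ('u, 'a) graded_lim \<Rightarrow> ('u, 'a) rflat" where
  "tensor k F = abs_rflat (free_tensor k F)"

text \<open>The structure map from \<open>K\<close>, and the degree \<open>d\<close> piece \<open>K \<otimes>\<^sub>A A[[[x\<^sub>i]]]\<^sub>d\<close>.\<close>

definition rflat_scalar :: "'a::idom fract \<Rightarrow> ('u, 'a) rflat" where
  "rflat_scalar k = tensor k 1"

definition rflat_piece :: "nat \<Rightarrow> ('u, 'a::idom) rflat set" where
  "rflat_piece d = add_subgroup hull {tensor k F | k F. F \<in> graded_lim_piece d}"

end

theory Submission
  imports Defs
begin

text \<open>The proof is a criterion for a graded algebra \<open>R\<close> with \<open>R\<^sub>0 = K\<close> to be a polynomial algebra: it is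
  enough that \<open>R\<close> has a family of Hasse derivations, that is, \<open>K\<close>-linear divided powers \<open>H i n\<close> of
  derivations with \<open>H i n\<close> lowering the degree by \<open>n\<close>, whose common kernel (over all \<open>n > 0\<close>) is \<open>K\<close>.
  On \<open>K \<otimes>\<^sub>A A[[[x\<^sub>i]]]\<close> the divided partial derivatives \<open>(1/n!) (\<partial>/\<partial>x\<^sub>i)\<^sup>n\<close> are such a family: a nonzero
  element of positive degree has a monomial \<open>x\<^sub>i\<^sup>n m\<close> with \<open>n > 0\<close>, where \<open>m\<close> does not contain \<open>x\<^sub>i\<close>, and \<open>H i n\<close>
  moves its coefficient, unchanged, to \<open>m\<close>.

  To prove the criterion, choose a set \<open>E\<close> of homogeneous elements that lifts a basis of
  \<open>R\<^sub>+ / R\<^sub>+\<^sup>2\<close> (\<open>exists_minimal_generators\<close>). It generates \<open>R\<close>, and the point is its algebraic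
  independence. Let \<open>p \<ge> 0\<close> be the characteristic of \<open>K\<close>.

  The first step (\<open>power_independent\<close>) treats the powers of one \<open>x \<in> E\<close> of degree \<open>d\<close> over the
  subalgebra \<open>B\<close> generated by all \<open>p\<close>-th powers and by the other elements of \<open>E\<close> of degree at most
  \<open>d\<close>. This \<open>B\<close> is stable under the Hasse derivations, contains everything of degree less than \<open>d\<close>,
  and does not contain \<open>x\<close>, because \<open>p\<close>-th powers are decomposable modulo \<open>K\<close>. Let
  \<open>a\<^sub>0 + a\<^sub>1 x + \<dots> + a\<^sub>n x\<^sup>n = 0\<close> be a nontrivial relation over \<open>B\<close> of least length, with \<open>n < p\<close>
  if \<open>p > 0\<close>. As \<open>H i m x\<close> lies in \<open>B\<close> for \<open>m > 0\<close>, applying \<open>H i m\<close> gives a relation with leading coefficient \<open>H i m a\<^sub>n\<close>, which has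
  smaller degree than \<open>a\<^sub>n\<close>; so one may assume that \<open>a\<^sub>n\<close> is killed by all \<open>H i m\<close>, hence is a nonzero
  constant. The derived relation then has length less than \<open>n\<close>, so its coefficient
  \<open>H i m (a\<^bsub>n-1\<^esub> + n a\<^sub>n x)\<close> at \<open>x\<^bsup>n-1\<^esup>\<close> vanishes. Hence \<open>a\<^bsub>n-1\<^esub> + n a\<^sub>n x\<close> is a constant and \<open>x \<in> B\<close>, a
  contradiction.

  It follows that the monomials in \<open>E\<close> with all exponents less than \<open>p\<close> are linearly independent
  over the subalgebra generated by the \<open>p\<close>-th powers. If \<open>p = 0\<close>, this is the claim. If \<open>p > 0\<close>, a
  relation between monomials thus splits into relations \<open>\<Sum> c\<^sub>j g\<^sub>j\<^sup>p = 0\<close> with monomials \<open>g\<^sub>j\<close> of smaller degree, and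
  these descend to nontrivial relations between the \<open>g\<^sub>j\<close> themselves
  (\<open>frobenius_splitting_relation\<close>): apply a splitting of the Frobenius map of \<open>K\<close> to the
  coefficients \<open>c\<^sub>j\<close>.\<close>


section \<open>Subalgebras, and power series in characteristic \<open>p\<close>\<close>

lemma subalgebra_hull: "subalgebra \<iota> (subalgebra \<iota> hull X)"
  by (rule hull_in) (simp add: subalgebra_def Inf_greatest)

locale algebra_over_field =
  fixes \<iota> :: "'k::field \<Rightarrow> 'r::comm_ring_1"
  assumes hom: "ring_homomorphism \<iota>"
begin

lemma \<iota>_1 [simp]: "\<iota> 1 = 1"
  and \<iota>_add: "\<iota> (a + b) = \<iota> a + \<iota> b"
  and \<iota>_mult: "\<iota> (a * b) = \<iota> a * \<iota> b"
  using hom by (auto simp: ring_homomorphism_def)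

lemma \<iota>_0 [simp]: "\<iota> 0 = 0"
  using \<iota>_add[of 0 0] by simp

lemma \<iota>_uminus: "\<iota> (- a) = - \<iota> a"
  using \<iota>_add[of "- a" a] by (metis \<iota>_0 add.left_inverse eq_neg_iff_add_eq_0)

lemma \<iota>_of_nat [simp]: "\<iota> (of_nat n) = of_nat n"
  by (induction n) (auto simp: \<iota>_add)

lemma \<iota>_power: "\<iota> (a ^ n) = \<iota> a ^ n"
  by (induction n) (auto simp: \<iota>_mult)

lemma \<iota>_sum: "\<iota> (sum f A) = (\<Sum>x\<in>A. \<iota> (f x))"
  by (induction A rule: infinite_finite_induct) (auto simp: \<iota>_add)

lemma \<iota>_eq_0_iff [simp]: "\<iota> a = 0 \<longleftrightarrow> a = 0"
proof
  assume "\<iota> a = 0"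
  show "a = 0"
  proof (rule ccontr)
    assume "a \<noteq> 0"
    hence "\<iota> a * \<iota> (inverse a) = 1" using \<iota>_mult[of a "inverse a"] by simp
    with \<open>\<iota> a = 0\<close> show False by simp
  qed
qed simp

lemma CHAR_eq: "CHAR('r) = CHAR('k)"
proof (rule CHAR_eqI)
  show "of_nat CHAR('k) = (0 :: 'r)"
    using \<iota>_of_nat[of "CHAR('k)"] by simp
  show "CHAR('k) dvd n" if "of_nat n = (0 :: 'r)" for n
  proof -
    have "\<iota> (of_nat n) = 0" using that by (simp only: \<iota>_of_nat)
    thus ?thesis by (simp only: \<iota>_eq_0_iff of_nat_eq_0_iff_char_dvd)
  qed
qed

sublocale vs: vector_space "\<lambda>c x. \<iota> c * x"
  by unfold_locales (auto simp: \<iota>_add \<iota>_mult algebra_simps)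

abbreviation adjoin :: "'r set \<Rightarrow> 'r set" where "adjoin X \<equiv> subalgebra \<iota> hull X"

lemma adjoin_add: "x \<in> adjoin X \<Longrightarrow> y \<in> adjoin X \<Longrightarrow> x + y \<in> adjoin X"
  and adjoin_mult: "x \<in> adjoin X \<Longrightarrow> y \<in> adjoin X \<Longrightarrow> x * y \<in> adjoin X"
  and adjoin_const: "\<iota> c \<in> adjoin X"
  using subalgebra_hull[of \<iota> X] by (auto simp: subalgebra_def)

lemma adjoin_0: "0 \<in> adjoin X" and adjoin_1: "1 \<in> adjoin X"
  using adjoin_const[of 0 X] adjoin_const[of 1 X] by auto

lemma adjoin_of_nat: "of_nat n \<in> adjoin X"
  using adjoin_const[of "of_nat n" X] by simp

lemma adjoin_uminus: "x \<in> adjoin X \<Longrightarrow> - x \<in> adjoin X"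
  using adjoin_mult[OF adjoin_const[of "- 1" X], of x] by (simp add: \<iota>_uminus)

lemma adjoin_diff: "x \<in> adjoin X \<Longrightarrow> y \<in> adjoin X \<Longrightarrow> x - y \<in> adjoin X"
  using adjoin_add[of x X "- y"] adjoin_uminus by simp

lemma adjoin_sum: "(\<And>i. i \<in> I \<Longrightarrow> f i \<in> adjoin X) \<Longrightarrow> sum f I \<in> adjoin X"
  by (induction I rule: infinite_finite_induct) (auto intro: adjoin_add adjoin_0)

lemma adjoin_prod: "(\<And>i. i \<in> I \<Longrightarrow> f i \<in> adjoin X) \<Longrightarrow> prod f I \<in> adjoin X"
  by (induction I rule: infinite_finite_induct) (auto intro: adjoin_mult adjoin_1)

lemma adjoin_power: "x \<in> adjoin X \<Longrightarrow> x ^ n \<in> adjoin X"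
  by (induction n) (auto intro: adjoin_mult adjoin_1)

lemmas adjoin_intros =
  adjoin_add adjoin_mult adjoin_const adjoin_0 adjoin_1 adjoin_of_nat adjoin_uminus adjoin_diff
  adjoin_sum adjoin_prod adjoin_power

text \<open>A Hasse derivation is a coefficient of a ring homomorphism into power series, so the statement
  that a subalgebra is stable under Hasse derivations reads: this homomorphism maps it to the power
  series with coefficients in it.\<close>

definition adjoin_fps :: "'r set \<Rightarrow> 'r fps set" where
  "adjoin_fps X = {f. \<forall>n. fps_nth f n \<in> adjoin X}"

lemma adjoin_fps_add: "f \<in> adjoin_fps X \<Longrightarrow> g \<in> adjoin_fps X \<Longrightarrow> f + g \<in> adjoin_fps X"
  and adjoin_fps_mult: "f \<in> adjoin_fps X \<Longrightarrow> g \<in> adjoin_fps X \<Longrightarrow> f * g \<in> adjoin_fps X"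
  and adjoin_fps_const: "x \<in> adjoin X \<Longrightarrow> fps_const x \<in> adjoin_fps X"
  by (auto simp: adjoin_fps_def fps_mult_nth intro!: adjoin_intros)

lemma adjoin_fps_of_nat: "of_nat n \<in> adjoin_fps X"
  using adjoin_fps_const[OF adjoin_of_nat[of n X]] by (simp add: fps_of_nat)

lemma adjoin_fps_power: "f \<in> adjoin_fps X \<Longrightarrow> f ^ n \<in> adjoin_fps X"
  using adjoin_fps_of_nat[of 1 X] by (induction n) (auto intro: adjoin_fps_mult)

lemma adjoin_fps_sum: "(\<And>i. i \<in> I \<Longrightarrow> f i \<in> adjoin_fps X) \<Longrightarrow> sum f I \<in> adjoin_fps X"
  using adjoin_fps_of_nat[of 0 X]
  by (induction I rule: infinite_finite_induct) (auto intro: adjoin_fps_add)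

end

text \<open>The \<open>n\<close>-th coefficient of a power depends only on the coefficients up to \<open>n\<close>, so that the
  additivity of the Frobenius map can be applied to the finite sum of the first \<open>n + 1\<close> terms.\<close>

lemma freshmans_dream_fps:
  fixes f :: "'r::comm_ring_1 fps"
  assumes "prime CHAR('r)"
  shows "fps_nth (f ^ CHAR('r)) n =
    (if CHAR('r) dvd n then fps_nth f (n div CHAR('r)) ^ CHAR('r) else 0)"
proof -
  let ?p = "CHAR('r)"
  have p: "prime CHAR('r fps)" "?p > 0" using assms by (auto simp: prime_gt_0_nat)
  define g where "g = (\<Sum>k\<le>n. fps_const (fps_nth f k) * fps_X ^ k)"
  have nth_g: "fps_nth g m = (if m \<le> n then fps_nth f m else 0)" for m
    by (simp add: g_def fps_sum_nth fps_X_power_nth if_distrib cong: if_cong)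
  have pow: "fps_nth (f ^ q) k = fps_nth (g ^ q) k" if "k \<le> n" for q k
    using that
  proof (induction q arbitrary: k)
    case (Suc q)
    thus ?case by (auto simp: fps_mult_nth nth_g intro!: sum.cong)
  qed simp
  have "g ^ ?p = (\<Sum>k\<le>n. (fps_const (fps_nth f k) * fps_X ^ k) ^ ?p)"
    unfolding g_def by (rule freshmans_dream_sum[OF p(1)]) simp
  hence "g ^ ?p = (\<Sum>k\<le>n. fps_const (fps_nth f k ^ ?p) * fps_X ^ (k * ?p))"
    by (simp add: power_mult_distrib fps_const_power flip: power_mult)
  hence "fps_nth (g ^ ?p) n = (\<Sum>k\<le>n. if n = k * ?p then fps_nth f k ^ ?p else 0)"
    by (simp add: fps_sum_nth fps_X_power_nth if_distrib cong: if_cong)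
  also have "\<dots> = (\<Sum>k\<le>n. if k = n div ?p then (if ?p dvd n then fps_nth f (n div ?p) ^ ?p else 0) else 0)"
    using p(2) by (intro sum.cong) auto
  also have "\<dots> = (if ?p dvd n then fps_nth f (n div ?p) ^ ?p else 0)"
    by simp
  finally show ?thesis using pow[of n ?p] by simp
qed


section \<open>Graded algebras and their minimal generators\<close>

lemma add_subgroup_sum:
  "add_subgroup S \<Longrightarrow> (\<And>i. i \<in> I \<Longrightarrow> f i \<in> S) \<Longrightarrow> sum f I \<in> S"
  by (induction I rule: infinite_finite_induct) (auto simp: add_subgroup_def)

text \<open>In characteristic zero the exponent is \<open>0\<close>, so that this set is \<open>{1}\<close> and contributes nothing to
  a generated subalgebra. This convention lets one argument cover all characteristics.\<close>

abbreviation CHAR_powers :: "'r::comm_ring_1 set" where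
  "CHAR_powers \<equiv> range (\<lambda>f. f ^ CHAR('r))"

locale graded_algebra = algebra_over_field \<iota> for \<iota> :: "'k::field \<Rightarrow> 'r::comm_ring_1" +
  fixes R :: "nat \<Rightarrow> 'r set"
  assumes grading: "ring_grading R"
    and R_0: "R 0 = range \<iota>"
begin

lemma subgroup_R: "add_subgroup (R d)"
  using grading by (simp add: ring_grading_def)

lemma R_zero [simp]: "0 \<in> R d" and R_add: "x \<in> R d \<Longrightarrow> y \<in> R d \<Longrightarrow> x + y \<in> R d"
  using subgroup_R by (auto simp: add_subgroup_def)

lemma R_mult: "x \<in> R i \<Longrightarrow> y \<in> R j \<Longrightarrow> x * y \<in> R (i + j)"
  using grading by (simp add: ring_grading_def)

lemma R_scale: "x \<in> R d \<Longrightarrow> \<iota> c * x \<in> R d"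
  using R_mult[of "\<iota> c" 0 x d] R_0 by auto

definition homogeneous_part :: "'r \<Rightarrow> nat \<Rightarrow> 'r" where
  "homogeneous_part x =
     (THE f. finite {d. f d \<noteq> 0} \<and> (\<forall>d. f d \<in> R d) \<and> x = (\<Sum>d | f d \<noteq> 0. f d))"

lemma homogeneous_part_props:
  "finite {d. homogeneous_part x d \<noteq> 0}" "homogeneous_part x d \<in> R d"
    "x = (\<Sum>d | homogeneous_part x d \<noteq> 0. homogeneous_part x d)"
proof -
  have "\<exists>!f. finite {d. f d \<noteq> 0} \<and> (\<forall>d. f d \<in> R d) \<and> x = (\<Sum>d | f d \<noteq> 0. f d)"
    using grading by (simp add: ring_grading_def)
  from theI'[OF this]
  show "finite {d. homogeneous_part x d \<noteq> 0}" "homogeneous_part x d \<in> R d"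
    "x = (\<Sum>d | homogeneous_part x d \<noteq> 0. homogeneous_part x d)"
    by (simp_all add: homogeneous_part_def)
qed

lemma homogeneous_part_eqI:
  assumes "finite D" "\<And>d. f d \<in> R d" "\<And>d. d \<notin> D \<Longrightarrow> f d = 0" "x = (\<Sum>d\<in>D. f d)"
  shows "homogeneous_part x = f"
proof -
  have ex1: "\<exists>!f. finite {d. f d \<noteq> 0} \<and> (\<forall>d. f d \<in> R d) \<and> x = (\<Sum>d | f d \<noteq> 0. f d)"
    using grading by (simp add: ring_grading_def)
  have sub: "{d. f d \<noteq> 0} \<subseteq> D" using assms(3) by blast
  have "x = (\<Sum>d | f d \<noteq> 0. f d)"
    unfolding assms(4) using assms(1) sub by (intro sum.mono_neutral_right) auto
  with finite_subset[OF sub assms(1)] assms(2)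
  show ?thesis unfolding homogeneous_part_def by (intro the1_equality[OF ex1]) blast
qed

lemma homogeneous_part_add: "homogeneous_part (x + y) d = homogeneous_part x d + homogeneous_part y d"
proof -
  let ?D = "{d. homogeneous_part x d \<noteq> 0} \<union> {d. homogeneous_part y d \<noteq> 0}"
  have D: "finite ?D" by (simp add: homogeneous_part_props(1))
  have "x = (\<Sum>d\<in>?D. homogeneous_part x d)" "y = (\<Sum>d\<in>?D. homogeneous_part y d)"
    using D by (subst homogeneous_part_props(3), intro sum.mono_neutral_left; auto)+
  hence "x + y = (\<Sum>d\<in>?D. homogeneous_part x d + homogeneous_part y d)"
    by (simp add: sum.distrib)
  hence "homogeneous_part (x + y) = (\<lambda>d. homogeneous_part x d + homogeneous_part y d)"
    using D by (intro homogeneous_part_eqI) (auto intro: R_add homogeneous_part_props)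
  thus ?thesis by simp
qed

lemma homogeneous_part_scale: "homogeneous_part (\<iota> c * x) d = \<iota> c * homogeneous_part x d"
proof -
  have "\<iota> c * x = (\<Sum>d | homogeneous_part x d \<noteq> 0. \<iota> c * homogeneous_part x d)"
    by (subst homogeneous_part_props(3)) (rule sum_distrib_left)
  hence "homogeneous_part (\<iota> c * x) = (\<lambda>d. \<iota> c * homogeneous_part x d)"
    by (intro homogeneous_part_eqI[of "{d. homogeneous_part x d \<noteq> 0}"])
      (auto intro: R_scale homogeneous_part_props)
  thus ?thesis by simp
qed

lemma homogeneous_part_of_homogeneous: "x \<in> R e \<Longrightarrow> homogeneous_part x d = (if d = e then x else 0)"
  by (subst homogeneous_part_eqI[of "{e}" "\<lambda>d. if d = e then x else 0"]) auto

lemma homogeneous_part_in_span: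
  assumes "\<And>b. b \<in> B \<Longrightarrow> b \<in> R (deg b)" "x \<in> vs.span B"
  shows "homogeneous_part x d \<in> vs.span {b \<in> B. deg b = d}"
proof -
  have 0: "homogeneous_part 0 e = 0" for e
    using homogeneous_part_scale[of 0 0 e] by simp
  have "vs.span B \<subseteq> {x. homogeneous_part x d \<in> vs.span {b \<in> B. deg b = d}}"
  proof (rule vs.span_minimal)
    show "B \<subseteq> {x. homogeneous_part x d \<in> vs.span {b \<in> B. deg b = d}}"
      using homogeneous_part_of_homogeneous[OF assms(1)] by (auto simp: vs.span_zero intro: vs.span_base)
  qed (auto simp: vs.subspace_def 0 homogeneous_part_add homogeneous_part_scale vs.span_zero
        intro: vs.span_add vs.span_scale)
  thus ?thesis using assms(2) by blast
qed

text \<open>The inductions below decrease the degree of an element that need not be homogeneous; an upper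
  bound for its degree is all that they keep track of.\<close>

definition degree_le :: "nat \<Rightarrow> 'r set" where
  "degree_le k = add_subgroup hull (\<Union>d\<le>k. R d)"

lemma R_subset_degree_le: "x \<in> R d \<Longrightarrow> d \<le> k \<Longrightarrow> x \<in> degree_le k"
  unfolding degree_le_def by (rule hull_inc) auto

lemma degree_le_exhaustive: "\<exists>k. x \<in> degree_le k"
proof -
  let ?D = "{d. homogeneous_part x d \<noteq> 0}"
  have "x = (\<Sum>d\<in>?D. homogeneous_part x d)" by (rule homogeneous_part_props)
  moreover have "homogeneous_part x d \<in> degree_le (Max ?D)" if "d \<in> ?D" for d
    using that homogeneous_part_props(1)[of x]
    by (intro R_subset_degree_le[OF homogeneous_part_props(2)] Max_ge)
  moreover have "add_subgroup (degree_le (Max ?D))"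
    by (simp add: degree_le_def add_subgroup_hull)
  ultimately have "x \<in> degree_le (Max ?D)"
    using add_subgroup_sum[of "degree_le (Max ?D)" ?D "homogeneous_part x"] by simp
  thus ?thesis by blast
qed

definition homogeneous_pos :: "'r set" where
  "homogeneous_pos = (\<Union>d\<in>{0<..}. R d)"

definition decomposables :: "'r set" where
  "decomposables = {x * y | x y. x \<in> homogeneous_pos \<and> y \<in> homogeneous_pos}"

lemma decomposables_homogeneous: "decomposables \<subseteq> homogeneous_pos"
  unfolding decomposables_def homogeneous_pos_def using R_mult by fastforce

text \<open>The span of \<open>homogeneous_pos\<close> is the ideal \<open>R\<^sub>+\<close>, and the span of \<open>decomposables\<close> is its square.\<close>

lemma span_pos_mult:
  assumes "x \<in> vs.span homogeneous_pos" "y \<in> vs.span homogeneous_pos"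
  shows "x * y \<in> vs.span decomposables"
proof -
  have 1: "vs.span homogeneous_pos \<subseteq> {y. x * y \<in> vs.span decomposables}"
    if "x \<in> homogeneous_pos" for x
  proof (rule vs.span_minimal)
    show "homogeneous_pos \<subseteq> {y. x * y \<in> vs.span decomposables}"
      using that by (auto simp: decomposables_def intro!: vs.span_base)
  qed (auto simp: vs.subspace_def distrib_left vs.span_zero mult.left_commute[of x]
      intro: vs.span_add vs.span_scale)
  have "vs.span homogeneous_pos \<subseteq> {x. x * y \<in> vs.span decomposables}"
  proof (rule vs.span_minimal)
    show "homogeneous_pos \<subseteq> {x. x * y \<in> vs.span decomposables}"
      using 1 assms(2) by blast
  qed (auto simp: vs.subspace_def distrib_right vs.span_zero mult.assoc
      intro: vs.span_add vs.span_scale)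
  thus ?thesis using assms(1) by blast
qed

lemma span_decomposables_subset: "vs.span decomposables \<subseteq> vs.span homogeneous_pos"
  by (intro vs.span_mono decomposables_homogeneous)

lemma span_pos_power:
  assumes "y \<in> vs.span homogeneous_pos" "n \<ge> 2"
  shows "y ^ n \<in> vs.span decomposables"
  using assms(2)
proof (induction n rule: dec_induct)
  case base
  show ?case using span_pos_mult[OF assms(1) assms(1)] by (simp add: power2_eq_square)
next
  case (step n)
  thus ?case using span_pos_mult[OF assms(1)] span_decomposables_subset by auto
qed

lemma const_plus_pos: "\<exists>c. \<exists>y\<in>vs.span homogeneous_pos. x = \<iota> c + y"
proof -
  let ?D = "{d. homogeneous_part x d \<noteq> 0}"
  have fin: "finite ?D" by (rule homogeneous_part_props)
  obtain c where c: "homogeneous_part x 0 = \<iota> c" using homogeneous_part_props(2)[of x 0] R_0 by auto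
  have "x = (\<Sum>d\<in>insert 0 ?D. homogeneous_part x d)"
    by (subst homogeneous_part_props(3), intro sum.mono_neutral_left) (auto simp: fin)
  also have "\<dots> = \<iota> c + (\<Sum>d\<in>?D - {0}. homogeneous_part x d)"
    using fin c by (simp add: sum.insert_remove)
  finally have "x = \<iota> c + (\<Sum>d\<in>?D - {0}. homogeneous_part x d)" .
  moreover have "(\<Sum>d\<in>?D - {0}. homogeneous_part x d) \<in> vs.span homogeneous_pos"
    by (rule vs.span_sum, rule vs.span_base)
      (auto simp: homogeneous_pos_def intro!: bexI[of _ "_::nat"] homogeneous_part_props)
  ultimately show ?thesis by blast
qed

lemma span_pos_const:
  assumes "\<iota> c \<in> vs.span homogeneous_pos"
  shows "c = 0"
proof -
  obtain deg where deg: "\<And>b. b \<in> homogeneous_pos \<Longrightarrow> 0 < deg b \<and> b \<in> R (deg b)"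
    unfolding homogeneous_pos_def using that by (metis UN_E greaterThan_iff)
  have "homogeneous_part (\<iota> c) 0 \<in> vs.span {b \<in> homogeneous_pos. deg b = 0}"
    using deg assms by (intro homogeneous_part_in_span) auto
  also have "{b \<in> homogeneous_pos. deg b = 0} = {}"
    using deg by fastforce
  finally show ?thesis
    using homogeneous_part_of_homogeneous[of "\<iota> c" 0 0] R_0 by simp
qed

text \<open>Extend a basis \<open>C\<close> of \<open>R\<^sub>+\<^sup>2\<close> that consists of products to a homogeneous basis \<open>B\<close> of \<open>R\<^sub>+\<close>; then
  \<open>E = B - C\<close> lifts a basis of \<open>R\<^sub>+ / R\<^sub>+\<^sup>2\<close>. That elements of degree \<open>d\<close> are polynomials in the
  generators of degree at most \<open>d\<close> follows by induction, since the factors of a product in \<open>C\<close> have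
  smaller degree.\<close>

lemma exists_minimal_generators:
  "\<exists>E deg. (\<forall>e\<in>E. 0 < deg e \<and> e \<in> R (deg e)) \<and>
     (\<forall>e\<in>E. e \<notin> vs.span (decomposables \<union> (E - {e}))) \<and>
     (\<forall>d. \<forall>x\<in>R d. x \<in> adjoin {e \<in> E. deg e \<le> d})"
proof -
  obtain deg where deg: "\<And>b. b \<in> homogeneous_pos \<Longrightarrow> 0 < deg b \<and> b \<in> R (deg b)"
    unfolding homogeneous_pos_def using that by (metis UN_E greaterThan_iff)
  obtain C where C: "C \<subseteq> decomposables" "vs.independent C" "decomposables \<subseteq> vs.span C"
    using vs.maximal_independent_subset by metis
  obtain B where B: "C \<subseteq> B" "B \<subseteq> homogeneous_pos" "vs.independent B" "homogeneous_pos \<subseteq> vs.span B"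
    using vs.maximal_independent_subset_extend[of C homogeneous_pos] C decomposables_homogeneous
    by (metis order_trans)
  define E where "E = B - C"
  have 1: "0 < deg e \<and> e \<in> R (deg e)" if "e \<in> E" for e
    using that B(2) deg by (auto simp: E_def)
  have 2: "e \<notin> vs.span (decomposables \<union> (E - {e}))" if "e \<in> E" for e
  proof -
    have "decomposables \<union> (E - {e}) \<subseteq> vs.span (B - {e})"
    proof -
      have "C \<subseteq> B - {e}" using that B(1) by (auto simp: E_def)
      hence "decomposables \<subseteq> vs.span (B - {e})" using C(3) vs.span_mono by blast
      moreover have "E - {e} \<subseteq> vs.span (B - {e})"
        by (auto simp: E_def intro: vs.span_base)
      ultimately show ?thesis by blast
    qed
    hence "vs.span (decomposables \<union> (E - {e})) \<subseteq> vs.span (B - {e})"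
      by (intro vs.span_minimal) auto
    moreover have "e \<notin> vs.span (B - {e})"
      using B(3) that unfolding vs.dependent_def E_def by blast
    ultimately show ?thesis by blast
  qed
  have 3: "x \<in> adjoin {e \<in> E. deg e \<le> d}" if "x \<in> R d" for x d
    using that
  proof (induction d arbitrary: x rule: less_induct)
    case (less d)
    let ?A = "adjoin {e \<in> E. deg e \<le> d}"
    have mono: "adjoin {e \<in> E. deg e \<le> i} \<subseteq> ?A" if "i \<le> d" for i
      using that by (intro hull_mono) auto
    show ?case
    proof (cases "d = 0")
      case True
      thus ?thesis using less.prems R_0 by (auto intro: adjoin_intros)
    next
      case False
      have "x \<in> vs.span B"
        using less.prems False B(4) by (auto simp: homogeneous_pos_def)
      hence "homogeneous_part x d \<in> vs.span {b \<in> B. deg b = d}"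
        using B(2) deg by (intro homogeneous_part_in_span) auto
      hence "x \<in> vs.span {b \<in> B. deg b = d}"
        using less.prems by (simp add: homogeneous_part_of_homogeneous)
      moreover have "vs.span {b \<in> B. deg b = d} \<subseteq> ?A"
      proof (rule vs.span_minimal)
        show "{b \<in> B. deg b = d} \<subseteq> ?A"
        proof safe
          fix b assume b: "b \<in> B" "d = deg b"
          show "b \<in> adjoin {e \<in> E. deg e \<le> deg b}"
          proof (cases "b \<in> C")
            case True
            then obtain u v i j where uv: "b = u * v" "i > 0" "j > 0" "u \<in> R i" "v \<in> R j"
              using C(1) by (auto simp: decomposables_def homogeneous_pos_def)
            have "b \<in> R d" using b deg B(2) by auto
            moreover have "b \<in> R (i + j)" using uv R_mult by simp
            moreover have "b \<noteq> 0" using B(3) b(1) vs.dependent_zero by metis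
            ultimately have "i + j = d"
              using homogeneous_part_of_homogeneous[of b d d]
                homogeneous_part_of_homogeneous[of b "i + j" d]
              by (auto split: if_splits)
            hence "u \<in> ?A" "v \<in> ?A"
              using less.IH[of i u] less.IH[of j v] uv mono[of i] mono[of j] by auto
            thus ?thesis using uv(1) b(2) by (auto intro: adjoin_intros)
          next
            case False
            thus ?thesis using b by (auto simp: E_def intro: hull_inc)
          qed
        qed
      qed (auto simp: vs.subspace_def intro: adjoin_intros)
      ultimately show ?thesis by blast
    qed
  qed
  show ?thesis
    by (rule exI[of _ E], rule exI[of _ deg]) (intro conjI, use 1 in blast, use 2 in blast, use 3 in blast)
qed

lemma adjoin_homogeneous_eq_UNIV:
  assumes "\<And>x d. x \<in> R d \<Longrightarrow> x \<in> adjoin X"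
  shows "adjoin X = UNIV"
proof -
  have "x \<in> adjoin X" for x
    by (subst homogeneous_part_props(3)[of x]) (auto intro: adjoin_intros assms homogeneous_part_props)
  thus ?thesis by blast
qed

text \<open>Writing \<open>x\<close> as \<open>c + y\<close> with \<open>y \<in> R\<^sub>+\<close> one has \<open>x\<^sup>p = c\<^sup>p + y\<^sup>p\<close> if \<open>p > 0\<close>, and \<open>y\<^sup>p\<close> is decomposable as \<open>p \<ge> 2\<close>;
  for \<open>p = 0\<close> the power is \<open>1\<close>.\<close>

lemma CHAR_power_decomposable:
  "\<exists>c. \<exists>y\<in>vs.span decomposables. x ^ CHAR('r) = \<iota> c + y"
proof (cases "CHAR('r) = 0")
  case True
  thus ?thesis by (intro exI[of _ 1] bexI[of _ 0]) (auto simp: vs.span_zero)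
next
  case False
  hence p: "prime CHAR('r)" using prime_CHAR_semidom[where 'a = 'k] by (simp add: CHAR_eq)
  obtain c y where y: "y \<in> vs.span homogeneous_pos" "x = \<iota> c + y"
    using const_plus_pos by blast
  have "y ^ CHAR('r) \<in> vs.span decomposables"
    using span_pos_power[OF y(1)] prime_ge_2_nat[OF p] by simp
  moreover have "x ^ CHAR('r) = \<iota> (c ^ CHAR('r)) + y ^ CHAR('r)"
    using freshmans_dream[OF p refl, of "\<iota> c" y] y(2) by (simp add: \<iota>_power)
  ultimately show ?thesis by blast
qed

text \<open>The subspace \<open>K + R\<^sub>+\<^sup>2 + span Y\<close> is closed under multiplication and contains all \<open>p\<close>-th powers, so it
  contains the subalgebra in question; by degree reasons it does not contain \<open>x\<close>.\<close>

lemma minimal_generator_notin_adjoin: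
  assumes x: "x \<in> homogeneous_pos" "x \<notin> vs.span (decomposables \<union> Y)" and Y: "Y \<subseteq> homogeneous_pos"
  shows "x \<notin> adjoin (CHAR_powers \<union> Y)"
proof
  let ?S = "vs.span (decomposables \<union> Y)"
  let ?W = "{\<iota> c + y | c y. y \<in> ?S}"
  have dec: "vs.span decomposables \<subseteq> ?S" by (intro vs.span_mono) auto
  have pos: "?S \<subseteq> vs.span homogeneous_pos"
    using Y decomposables_homogeneous by (intro vs.span_mono) auto
  assume "x \<in> adjoin (CHAR_powers \<union> Y)"
  also have "adjoin (CHAR_powers \<union> Y) \<subseteq> ?W"
  proof (rule hull_minimal)
    show "CHAR_powers \<union> Y \<subseteq> ?W"
    proof (intro Un_least subsetI)
      fix y :: 'r assume "y \<in> CHAR_powers"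
      thus "y \<in> ?W" using CHAR_power_decomposable dec by fast
    next
      fix y assume "y \<in> Y"
      hence "y = \<iota> 0 + y" "y \<in> ?S" by (auto intro: vs.span_base)
      thus "y \<in> ?W" by blast
    qed
    show "subalgebra \<iota> ?W"
      unfolding subalgebra_def
    proof (intro conjI ballI)
      show "range \<iota> \<subseteq> ?W"
        using vs.span_zero[of "decomposables \<union> Y"] by force
    next
      fix u v assume "u \<in> ?W" "v \<in> ?W"
      then obtain a b y z where u: "u = \<iota> a + y" "y \<in> ?S" and v: "v = \<iota> b + z" "z \<in> ?S"
        by blast
      have "u + v = \<iota> (a + b) + (y + z)" "y + z \<in> ?S"
        using u v by (auto simp: \<iota>_add intro: vs.span_add)
      thus "u + v \<in> ?W" by blast
      have "y * z \<in> ?S" using span_pos_mult u(2) v(2) pos dec by blast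
      hence "\<iota> a * z + \<iota> b * y + y * z \<in> ?S"
        using u(2) v(2) by (intro vs.span_add vs.span_scale)
      moreover have "u * v = \<iota> (a * b) + (\<iota> a * z + \<iota> b * y + y * z)"
        by (simp add: u v \<iota>_mult algebra_simps)
      ultimately show "u * v \<in> ?W" by blast
    qed
  qed
  finally obtain c y where y: "x = \<iota> c + y" "y \<in> ?S" by blast
  hence "\<iota> c = x - y" by simp
  hence "\<iota> c \<in> vs.span homogeneous_pos"
    using x(1) y(2) pos by (auto intro: vs.span_diff vs.span_base)
  hence "c = 0" by (rule span_pos_const)
  thus False using x(2) y by simp
qed

end


section \<open>Hasse derivations and monomials with small exponents\<close>

text \<open>For each \<open>i\<close>, the operators \<open>H i 0\<close>, \<open>H i 1\<close>, \<dots> form a Hasse-Schmidt derivation over \<open>K\<close>. The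
  models are the divided powers \<open>(1/n!) (\<partial>/\<partial>x\<^sub>i)\<^sup>n\<close>, which make sense in every characteristic. The last
  assumption says that there are enough of them: positive degree is detected by derivatives.\<close>

locale hasse_algebra = graded_algebra \<iota> R
  for \<iota> :: "'k::field \<Rightarrow> 'r::comm_ring_1" and R :: "nat \<Rightarrow> 'r set" +
  fixes H :: "'i \<Rightarrow> nat \<Rightarrow> 'r \<Rightarrow> 'r"
  assumes H_0: "H i 0 x = x"
    and H_add: "H i n (x + y) = H i n x + H i n y"
    and H_mult: "H i n (x * y) = (\<Sum>j\<le>n. H i j x * H i (n - j) y)"
    and H_const: "n > 0 \<Longrightarrow> H i n (\<iota> c) = 0"
    and H_degree: "x \<in> R d \<Longrightarrow> n \<le> d \<Longrightarrow> H i n x \<in> R (d - n)"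
    and H_degree_less: "x \<in> R d \<Longrightarrow> d < n \<Longrightarrow> H i n x = 0"
    and enough: "(\<And>i n. n > 0 \<Longrightarrow> H i n x = 0) \<Longrightarrow> x \<in> range \<iota>"
begin

text \<open>For the divided partial derivatives this is the expansion of \<open>x\<close> after the substitution of
  \<open>x\<^sub>i + t\<close> for \<open>x\<^sub>i\<close>. The Leibniz rule says that it is a ring homomorphism, which reduces
  formulas for \<open>H\<close> on powers to the binomial theorem and to \<open>freshmans_dream_fps\<close>.\<close>

definition taylor :: "'i \<Rightarrow> 'r \<Rightarrow> 'r fps" where
  "taylor i x = Abs_fps (\<lambda>n. H i n x)"

lemma taylor_nth [simp]: "fps_nth (taylor i x) n = H i n x"
  by (simp add: taylor_def)

lemma taylor_add: "taylor i (x + y) = taylor i x + taylor i y"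
  by (rule fps_ext) (simp add: H_add)

lemma taylor_mult: "taylor i (x * y) = taylor i x * taylor i y"
  by (rule fps_ext) (simp add: H_mult fps_mult_nth atLeast0AtMost)

lemma taylor_const: "taylor i (\<iota> c) = fps_const (\<iota> c)"
  by (rule fps_ext) (auto simp: H_0 H_const)

lemma taylor_0: "taylor i 0 = 0" and taylor_1: "taylor i 1 = 1"
  using taylor_const[of i 0] taylor_const[of i 1] by auto

lemma taylor_power: "taylor i (x ^ n) = taylor i x ^ n"
  by (induction n) (auto simp: taylor_1 taylor_mult)

lemma taylor_sum: "taylor i (sum f A) = (\<Sum>x\<in>A. taylor i (f x))"
  by (induction A rule: infinite_finite_induct) (auto simp: taylor_0 taylor_add)

lemma H_zero [simp]: "H i n 0 = 0"
  using taylor_0[of i] by (metis fps_zero_nth taylor_nth)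

lemma H_sum: "H i n (sum f A) = (\<Sum>x\<in>A. H i n (f x))"
  by (induction A rule: infinite_finite_induct) (auto simp: H_add)

lemma H_scale: "H i n (\<iota> c * x) = \<iota> c * H i n x"
  using taylor_mult[of i "\<iota> c" x] by (simp add: taylor_const fps_eq_iff)

lemma H_uminus: "H i n (- x) = - H i n x"
  using H_scale[of i n "- 1" x] by (simp add: \<iota>_uminus)

lemma H_CHAR_power:
  assumes "CHAR('r) > 0"
  shows "H i n (x ^ CHAR('r)) = (if CHAR('r) dvd n then H i (n div CHAR('r)) x ^ CHAR('r) else 0)"
proof -
  have "prime CHAR('r)" using assms prime_CHAR_semidom[where 'a = 'k] by (simp add: CHAR_eq)
  from freshmans_dream_fps[OF this, of "taylor i x" n] show ?thesis
    by (simp flip: taylor_power)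
qed

lemma H_degree_le:
  assumes "x \<in> degree_le k" "n > 0"
  shows "H i n x = 0 \<or> (k > 0 \<and> H i n x \<in> degree_le (k - 1))"
proof -
  let ?S = "{x. H i n x \<in> (if k = 0 then {0} else degree_le (k - 1))}"
  have "degree_le k \<subseteq> ?S"
    unfolding degree_le_def[of k]
  proof (rule hull_minimal)
    show "(\<Union>d\<le>k. R d) \<subseteq> ?S"
    proof safe
      fix d x assume d: "d \<le> k" "x \<in> R d"
      show "H i n x \<in> (if k = 0 then {0} else degree_le (k - 1))"
      proof (cases "n \<le> d")
        case True
        hence "H i n x \<in> degree_le (k - 1)"
          using d assms(2) by (intro R_subset_degree_le[OF H_degree]) auto
        thus ?thesis using True d assms(2) by auto
      next
        case False
        thus ?thesis using H_degree_less[OF d(2)] R_subset_degree_le[OF R_zero, of 0] by auto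
      qed
    qed
    have "add_subgroup (degree_le (k - 1))" by (simp add: degree_le_def add_subgroup_hull)
    thus "add_subgroup ?S" by (auto simp: add_subgroup_def H_add H_uminus)
  qed
  thus ?thesis using assms(1) by (auto split: if_splits)
qed

lemma taylor_adjoin:
  assumes "\<And>x n. x \<in> X \<Longrightarrow> H i n x \<in> adjoin X" "y \<in> adjoin X"
  shows "taylor i y \<in> adjoin_fps X"
proof -
  have "adjoin X \<subseteq> {y. taylor i y \<in> adjoin_fps X}"
  proof (rule hull_minimal)
    show "X \<subseteq> {y. taylor i y \<in> adjoin_fps X}"
      using assms(1) by (auto simp: adjoin_fps_def)
    show "subalgebra \<iota> {y. taylor i y \<in> adjoin_fps X}"
      using adjoin_fps_const[OF adjoin_const]
      by (auto simp: subalgebra_def taylor_add taylor_mult taylor_const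
          intro: adjoin_fps_add adjoin_fps_mult)
  qed
  thus ?thesis using assms(2) by blast
qed

lemma H_CHAR_powers: "y \<in> CHAR_powers \<Longrightarrow> H i n y \<in> adjoin CHAR_powers"
proof (cases "CHAR('r) = 0")
  case True
  assume "y \<in> CHAR_powers"
  hence "y = 1" using True by auto
  hence "H i n y \<in> {0, 1}"
    using H_const[of n i 1] H_0[of i 1] by (cases n) auto
  thus ?thesis by (auto intro: adjoin_intros)
next
  case False
  assume "y \<in> CHAR_powers"
  then obtain f where "y = f ^ CHAR('r)" by blast
  thus ?thesis using H_CHAR_power[of i n f] False by (auto intro: hull_inc adjoin_intros)
qed

text \<open>Applying \<open>H i m\<close> to a relation between the powers of \<open>x\<close>. Write \<open>taylor i x = x + v\<close>, where the
  coefficients of \<open>v\<close> lie in the coefficient ring, expand the powers of \<open>x + v\<close>, and collect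
  the powers of \<open>x\<close>. The number of terms does not grow, the leading coefficient is just
  differentiated, and the next one is known explicitly when the leading one is a constant.\<close>

lemma taylor_shift_relation:
  fixes a :: "nat \<Rightarrow> 'r"
  assumes rel: "(\<Sum>l\<le>n. a l * x ^ l) = 0"
    and a: "\<And>l. l \<le> n \<Longrightarrow> taylor i (a l) \<in> adjoin_fps X"
    and x: "\<And>m. m > 0 \<Longrightarrow> H i m x \<in> adjoin X"
  shows "\<exists>b. (\<Sum>l\<le>n. b l * x ^ l) = 0 \<and> (\<forall>l\<le>n. b l \<in> adjoin X) \<and>
    b n = H i m (a n) \<and>
    (n > 0 \<longrightarrow> (\<forall>j>0. H i j (a n) = 0) \<longrightarrow> m > 0 \<longrightarrow>
       b (n - 1) = H i m (a (n - 1)) + of_nat n * a n * H i m x)"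
proof (intro exI conjI)
  let ?X = "fps_const x"
  define v where "v = taylor i x - ?X"
  have nth_v: "fps_nth v m = (if m = 0 then 0 else H i m x)" for m
    by (auto simp: v_def H_0)
  have v: "v \<in> adjoin_fps X"
    using x by (auto simp: adjoin_fps_def nth_v intro: adjoin_0)
  define c where "c r = (\<Sum>l\<in>{r..n}. of_nat (l choose r) * taylor i (a l) * v ^ (l - r))" for r
  define b where "b r = fps_nth (c r) m" for r
  have "0 = taylor i (\<Sum>l\<le>n. a l * x ^ l)" by (simp add: rel taylor_0)
  also have "\<dots> = (\<Sum>l\<le>n. taylor i (a l) * (?X + v) ^ l)"
    by (simp add: taylor_sum taylor_mult taylor_power v_def)
  also have "\<dots> = (\<Sum>l\<le>n. \<Sum>r\<le>l. of_nat (l choose r) * taylor i (a l) * v ^ (l - r) * ?X ^ r)"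
    by (simp add: binomial_ring sum_distrib_left mult_ac)
  also have "\<dots> = (\<Sum>r\<le>n. \<Sum>l\<in>{r..n}. of_nat (l choose r) * taylor i (a l) * v ^ (l - r) * ?X ^ r)"
    (is "(\<Sum>l\<le>n. \<Sum>r\<le>l. ?g l r) = _")
  proof -
    have "(\<Sum>l\<le>n. \<Sum>r\<le>l. ?g l r) = (\<Sum>l\<le>n. \<Sum>r | r \<in> {..n} \<and> r \<le> l. ?g l r)"
      by (intro sum.cong) auto
    also have "\<dots> = (\<Sum>r\<le>n. \<Sum>l | l \<in> {..n} \<and> r \<le> l. ?g l r)"
      by (rule sum.swap_restrict) auto
    also have "\<dots> = (\<Sum>r\<le>n. \<Sum>l\<in>{r..n}. ?g l r)"
      by (intro sum.cong) auto
    finally show ?thesis .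
  qed
  also have "\<dots> = (\<Sum>r\<le>n. c r * ?X ^ r)"
    by (simp add: c_def sum_distrib_right)
  finally have "fps_nth (\<Sum>r\<le>n. c r * ?X ^ r) m = 0" by simp
  thus "(\<Sum>l\<le>n. b l * x ^ l) = 0"
    by (simp add: fps_sum_nth b_def fps_const_power)
  show "\<forall>l\<le>n. b l \<in> adjoin X"
  proof (intro allI impI)
    fix l assume "l \<le> n"
    have "c l \<in> adjoin_fps X" unfolding c_def
      using a v by (intro adjoin_fps_sum adjoin_fps_mult adjoin_fps_of_nat adjoin_fps_power) auto
    thus "b l \<in> adjoin X" by (simp add: b_def adjoin_fps_def)
  qed
  show "b n = H i m (a n)" by (simp add: b_def c_def)
  show "n > 0 \<longrightarrow> (\<forall>j>0. H i j (a n) = 0) \<longrightarrow> m > 0 \<longrightarrow>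
       b (n - 1) = H i m (a (n - 1)) + of_nat n * a n * H i m x"
  proof (intro impI)
    assume n: "n > 0" and an: "\<forall>j>0. H i j (a n) = 0" and "m > 0"
    have "{n - 1..n} = {n - 1, n}" using n by auto
    moreover have "n choose (n - 1) = n"
      using n binomial_symmetric[of 1 n] by simp
    ultimately have "c (n - 1) = taylor i (a (n - 1)) + of_nat n * taylor i (a n) * v"
      using n by (simp add: c_def)
    moreover have "taylor i (a n) = fps_const (a n)"
      using an by (auto simp: fps_eq_iff H_0)
    moreover have "of_nat n * fps_const (a n) * v = fps_const (of_nat n * a n) * v"
      by (simp flip: fps_of_nat)
    ultimately have "c (n - 1) = taylor i (a (n - 1)) + fps_const (of_nat n * a n) * v"
      by simp
    thus "b (n - 1) = H i m (a (n - 1)) + of_nat n * a n * H i m x"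
      using \<open>m > 0\<close> by (simp add: b_def nth_v)
  qed
qed

context
  fixes E :: "'r set" and deg :: "'r \<Rightarrow> nat"
  assumes E_deg: "\<And>e. e \<in> E \<Longrightarrow> 0 < deg e \<and> e \<in> R (deg e)"
    and E_minimal: "\<And>e. e \<in> E \<Longrightarrow> e \<notin> vs.span (decomposables \<union> (E - {e}))"
    and E_generates: "\<And>x d. x \<in> R d \<Longrightarrow> x \<in> adjoin {e \<in> E. deg e \<le> d}"
begin

text \<open>Induction on the length \<open>n\<close> and, for fixed length, on the degree of the leading coefficient.
  The bound on \<open>n\<close> makes the factor \<open>n\<close> in the coefficient at \<open>x\<^bsup>n-1\<^esup>\<close> invertible.\<close>

lemma power_independent:
  fixes a :: "nat \<Rightarrow> 'r"
  assumes x: "x \<in> E"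
    and X: "X = CHAR_powers \<union> ({e \<in> E. deg e \<le> deg x} - {x})"
    and "CHAR('r) = 0 \<or> n < CHAR('r)"
    and "\<And>l. l \<le> n \<Longrightarrow> a l \<in> adjoin X" "(\<Sum>l\<le>n. a l * x ^ l) = 0" "l \<le> n"
  shows "a l = 0"
proof -
  have low: "y \<in> adjoin X" if "y \<in> R d" "d < deg x" for y d
  proof -
    have "adjoin {e \<in> E. deg e \<le> d} \<subseteq> adjoin X"
      using that(2) by (intro hull_mono) (auto simp: X)
    thus ?thesis using E_generates[OF that(1)] by blast
  qed
  have H_low: "H i m e \<in> adjoin X" if "e \<in> E" "deg e \<le> deg x" "m > 0" for i m e
    using low[OF H_degree[of e "deg e" m i]] H_degree_less[of e "deg e" m i] E_deg that
    by (cases "m \<le> deg e") (auto intro: adjoin_0)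
  have H_X: "H i m e \<in> adjoin X" if "e \<in> X" for i m e
  proof (cases "e \<in> CHAR_powers")
    case True
    have "adjoin CHAR_powers \<subseteq> adjoin X" by (intro hull_mono) (auto simp: X)
    thus ?thesis using H_CHAR_powers[OF True] by blast
  next
    case False
    thus ?thesis using that H_low[of e m i] H_0[of i e] hull_inc[OF that, of "subalgebra \<iota>"]
      by (cases "m = 0") (auto simp: X)
  qed
  have notin: "x \<notin> adjoin X"
    unfolding X
  proof (rule minimal_generator_notin_adjoin)
    have "vs.span (decomposables \<union> ({e \<in> E. deg e \<le> deg x} - {x})) \<subseteq>
        vs.span (decomposables \<union> (E - {x}))"
      by (intro vs.span_mono) auto
    thus "x \<notin> vs.span (decomposables \<union> ({e \<in> E. deg e \<le> deg x} - {x}))"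
      using E_minimal[OF x] by blast
  qed (use E_deg x in \<open>auto simp: homogeneous_pos_def\<close>)
  from assms(3-) show ?thesis
  proof (induction n arbitrary: a l rule: less_induct)
    case (less n)
    have shorter: "\<forall>l\<le>n. b l = 0"
      if b: "\<And>l. l \<le> n \<Longrightarrow> b l \<in> adjoin X" "(\<Sum>l\<le>n. b l * x ^ l) = 0" and "b n = 0" for b
    proof (cases n)
      case 0
      thus ?thesis using that by simp
    next
      case (Suc n')
      hence "(\<Sum>l\<le>n'. b l * x ^ l) = 0" using that by simp
      hence "b l = 0" if "l \<le> n'" for l
        using that less.IH[of n' b l] b(1) less.prems(1) Suc by auto
      thus ?thesis using \<open>b n = 0\<close> Suc by (auto simp: le_Suc_eq)
    qed
    \<comment> \<open>It is enough to see that the leading coefficient vanishes; then \<open>shorter\<close> applies.\<close>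
    have top: "b n = 0"
      if "b n \<in> degree_le k" "\<And>l. l \<le> n \<Longrightarrow> b l \<in> adjoin X" "(\<Sum>l\<le>n. b l * x ^ l) = 0" for b k
      using that
    proof (induction k arbitrary: b rule: less_induct)
      case (less k)
      have tay: "taylor i (b l) \<in> adjoin_fps X" if "l \<le> n" for i l
        using taylor_adjoin[OF H_X less.prems(2)[OF that]] .
      note shift = taylor_shift_relation[OF less.prems(3) tay H_low[OF x order_refl]]
      have const: "H i m (b n) = 0" if "m > 0" for i m
      proof (rule ccontr)
        assume nz: "H i m (b n) \<noteq> 0"
        obtain c where c: "(\<Sum>l\<le>n. c l * x ^ l) = 0" "\<And>l. l \<le> n \<Longrightarrow> c l \<in> adjoin X"
            "c n = H i m (b n)"
          using shift[of i m] by blast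
        show False
          using H_degree_le[OF less.prems(1) that, of i] nz less.IH[of "k - 1" c] c by auto
      qed
      obtain c where c: "b n = \<iota> c" using enough[OF const] by blast
      show ?case
      proof (cases "n = 0")
        case True
        thus ?thesis using less.prems(3) by simp
      next
        case False
        have next_coeff: "H i m (b (n - 1)) + of_nat n * b n * H i m x = 0" if "m > 0" for i m
        proof -
          obtain c where c: "(\<Sum>l\<le>n. c l * x ^ l) = 0" "\<And>l. l \<le> n \<Longrightarrow> c l \<in> adjoin X"
              "c n = H i m (b n)" "n > 0 \<longrightarrow> (\<forall>j>0. H i j (b n) = 0) \<longrightarrow> m > 0 \<longrightarrow>
                c (n - 1) = H i m (b (n - 1)) + of_nat n * b n * H i m x"
            using shift[of i m] by blast
          have "c n = 0" using c(3) const[OF that] by simp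
          with shorter[of c] c(1,2) have "c (n - 1) = 0" by simp
          thus ?thesis using c(4) False that const by simp
        qed
        \<comment> \<open>All derivatives of \<open>b (n - 1) + u x\<close> vanish, so it is a constant, and \<open>x\<close> would lie in
            the coefficient ring unless \<open>u = 0\<close>.\<close>
        define u where "u = of_nat n * c"
        have u: "\<iota> u = of_nat n * b n" by (simp add: u_def c \<iota>_mult)
        have "b (n - 1) + \<iota> u * x \<in> range \<iota>"
          by (rule enough) (simp only: H_add H_scale, simp only: u next_coeff)
        then obtain c' where "b (n - 1) + \<iota> u * x = \<iota> c'" by blast
        hence "\<iota> u * x = \<iota> c' - b (n - 1)" by (simp add: algebra_simps)
        hence "\<iota> u * x \<in> adjoin X" using less.prems(2)[of "n - 1"] by (auto intro: adjoin_intros)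
        hence "\<iota> (inverse u) * (\<iota> u * x) \<in> adjoin X" by (rule adjoin_mult[OF adjoin_const])
        hence "\<iota> (inverse u * u) * x \<in> adjoin X" by (simp only: \<iota>_mult mult.assoc)
        hence "u = 0" using notin by (cases "u = 0") auto
        moreover have "of_nat n \<noteq> (0 :: 'k)"
          using False less.prems(1) \<open>CHAR('r) = 0 \<or> n < CHAR('r)\<close>
          by (auto simp: of_nat_eq_0_iff_char_dvd CHAR_eq dest: dvd_imp_le)
        ultimately show ?thesis by (simp add: u_def c)
      qed
    qed
    obtain k where "a n \<in> degree_le k" using degree_le_exhaustive by blast
    hence "a n = 0" using top less.prems by blast
    thus ?case using shorter[of a] less.prems by blast
  qed
qed

end

end


section \<open>Descent along Frobenius and algebraic independence\<close>

definition monom_value :: "('r::comm_ring_1 \<Rightarrow>\<^sub>0 nat) \<Rightarrow> 'r" where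
  "monom_value m = (\<Prod>v\<in>Poly_Mapping.keys m. v ^ Poly_Mapping.lookup m v)"

lemma monom_value_superset:
  "finite V \<Longrightarrow> Poly_Mapping.keys m \<subseteq> V \<Longrightarrow> monom_value m = (\<Prod>v\<in>V. v ^ Poly_Mapping.lookup m v)"
  unfolding monom_value_def by (rule prod.mono_neutral_left) (auto simp: in_keys_iff)

lemma monom_value_0 [simp]: "monom_value 0 = 1"
  by (simp add: monom_value_def)

lemma monom_value_split:
  "monom_value m = monom_value (m - Poly_Mapping.single x (Poly_Mapping.lookup m x)) *
     x ^ Poly_Mapping.lookup m x"
proof -
  let ?V = "insert x (Poly_Mapping.keys m)" and ?l = "Poly_Mapping.lookup m x"
  have "monom_value m = x ^ ?l * (\<Prod>v\<in>Poly_Mapping.keys m - {x}. v ^ Poly_Mapping.lookup m v)"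
    using monom_value_superset[of ?V m] by (auto simp: prod.insert_remove)
  also have "(\<Prod>v\<in>Poly_Mapping.keys m - {x}. v ^ Poly_Mapping.lookup m v) =
      monom_value (m - Poly_Mapping.single x ?l)"
    unfolding monom_value_def
    by (rule prod.cong) (auto simp: in_keys_iff lookup_minus lookup_single when_def split: if_splits)
  finally show ?thesis by (simp add: mult.commute)
qed

text \<open>Division with remainder of all exponents by \<open>p\<close>. For \<open>p = 0\<close> the quotient is \<open>0\<close> and the remainder is
  the monomial itself.\<close>

definition div_monom :: "('v \<Rightarrow>\<^sub>0 nat) \<Rightarrow> nat \<Rightarrow> ('v \<Rightarrow>\<^sub>0 nat)" where
  "div_monom m p = Poly_Mapping.map (\<lambda>n. n div p) m"

definition mod_monom :: "('v \<Rightarrow>\<^sub>0 nat) \<Rightarrow> nat \<Rightarrow> ('v \<Rightarrow>\<^sub>0 nat)" where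
  "mod_monom m p = Poly_Mapping.map (\<lambda>n. n mod p) m"

lemma lookup_div_monom: "Poly_Mapping.lookup (div_monom m p) v = Poly_Mapping.lookup m v div p"
  and lookup_mod_monom: "Poly_Mapping.lookup (mod_monom m p) v = Poly_Mapping.lookup m v mod p"
  by (simp_all add: div_monom_def mod_monom_def Poly_Mapping.map.rep_eq when_def)

lemma keys_div_monom: "Poly_Mapping.keys (div_monom m p) \<subseteq> Poly_Mapping.keys m"
  and keys_mod_monom: "Poly_Mapping.keys (mod_monom m p) \<subseteq> Poly_Mapping.keys m"
  by (rule subsetI, simp only: in_keys_iff lookup_div_monom lookup_mod_monom, rule notI, simp)+

lemma div_mod_monom_inject:
  assumes "div_monom m p = div_monom n p" "mod_monom m p = mod_monom n p"
  shows "m = n"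
proof (rule poly_mapping_eqI)
  fix v
  from assms have "Poly_Mapping.lookup m v div p = Poly_Mapping.lookup n v div p"
    "Poly_Mapping.lookup m v mod p = Poly_Mapping.lookup n v mod p"
    by (metis lookup_div_monom, metis lookup_mod_monom)
  thus "Poly_Mapping.lookup m v = Poly_Mapping.lookup n v"
    by (metis div_mult_mod_eq)
qed

lemma monom_value_div_mod: "monom_value m = monom_value (div_monom m p) ^ p * monom_value (mod_monom m p)"
proof -
  let ?K = "Poly_Mapping.keys m"
  have "monom_value (div_monom m p) ^ p * monom_value (mod_monom m p) =
      (\<Prod>v\<in>?K. (v ^ (Poly_Mapping.lookup m v div p)) ^ p * v ^ (Poly_Mapping.lookup m v mod p))"
    using monom_value_superset[of ?K "div_monom m p"] monom_value_superset[of ?K "mod_monom m p"]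
      keys_div_monom[of m p] keys_mod_monom[of m p]
    by (simp add: prod_power_distrib prod.distrib lookup_div_monom lookup_mod_monom)
  also have "\<dots> = (\<Prod>v\<in>?K. v ^ Poly_Mapping.lookup m v)"
    by (intro prod.cong) (simp_all add: div_mult_mod_eq flip: power_mult power_add)
  finally show ?thesis by (simp add: monom_value_def)
qed

lemma mono_degree_div_monom: "mono_degree (div_monom m p) * p \<le> mono_degree m"
proof -
  let ?K = "Poly_Mapping.keys m"
  have "mono_degree (div_monom m p) * p = (\<Sum>v\<in>?K. (Poly_Mapping.lookup m v div p) * p)"
    using mono_degree_superset[of ?K "div_monom m p"] keys_div_monom[of m p]
    by (simp add: sum_distrib_right lookup_div_monom)
  also have "\<dots> \<le> mono_degree m"
    unfolding mono_degree_def by (intro sum_mono) simp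
  finally show ?thesis .
qed

lemma mono_degree_eq_0: "mono_degree m = 0 \<Longrightarrow> m = 0"
  by (auto simp: mono_degree_def in_keys_iff poly_mapping_eq_iff fun_eq_iff)

text \<open>Extend \<open>1\<close> to a basis of \<open>K\<close> over \<open>K\<^sup>p\<close> and take the resulting \<open>K\<^sup>p\<close>-linear projection of \<open>K\<close> to
  \<open>K\<^sup>p\<close>, followed by the \<open>p\<close>-th root. The roots are avoided by viewing \<open>K\<close> as a vector space over \<open>K\<close>
  through the Frobenius map.\<close>

lemma exists_frobenius_splitting:
  assumes "CHAR('k::field) > 0"
  shows "\<exists>\<mu> :: 'k \<Rightarrow> 'k. (\<forall>x y. \<mu> (x + y) = \<mu> x + \<mu> y) \<and>
    (\<forall>c a. \<mu> (c * a ^ CHAR('k)) = \<mu> c * a) \<and> \<mu> 1 = 1"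
proof -
  have p: "prime CHAR('k)" using assms prime_CHAR_semidom by blast
  interpret V: vector_space "\<lambda>a c :: 'k. a ^ CHAR('k) * c"
    by unfold_locales
      (auto simp: distrib_left distrib_right freshmans_dream[OF p refl] power_mult_distrib mult_ac)
  interpret W: vector_space "(*) :: 'k \<Rightarrow> 'k \<Rightarrow> 'k"
    by unfold_locales (auto simp: distrib_left distrib_right mult_ac)
  interpret VW: vector_space_pair "\<lambda>a c :: 'k. a ^ CHAR('k) * c" "(*) :: 'k \<Rightarrow> 'k \<Rightarrow> 'k"
    by unfold_locales
  have "\<not> V.dependent {1}" by (simp add: V.dependent_single)
  from VW.linear_independent_extend[OF this, of "\<lambda>x. x"] obtain \<mu> :: "'k \<Rightarrow> 'k" where
    "Vector_Spaces.linear (\<lambda>a c. a ^ CHAR('k) * c) (*) \<mu> \<and> (\<forall>x\<in>{1}. \<mu> x = x)"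
    by blast
  hence \<mu>: "Vector_Spaces.linear (\<lambda>a c. a ^ CHAR('k) * c) (*) \<mu>" "\<mu> 1 = 1"
    by auto
  interpret L: Vector_Spaces.linear "\<lambda>a c :: 'k. a ^ CHAR('k) * c" "(*)" \<mu> by fact
  show ?thesis
    using L.add L.scale \<mu>(2) by (intro exI[of _ \<mu>]) (simp add: mult.commute)
qed

context hasse_algebra
begin

text \<open>In a power series ring one would apply \<open>\<mu>\<close> to the coefficients of both sides. The Hasse derivations
  replace coefficients: by induction on the degree of the \<open>g j\<close> and as \<open>H i (n p)\<close> maps \<open>g\<^sup>p\<close> to
  \<open>(H i n g)\<^sup>p\<close>, all derivatives of the left-hand side vanish, so that it is a constant, and constant
  terms can be computed in \<open>K\<close>.\<close>

lemma frobenius_splitting_relation: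
  assumes p: "CHAR('r) > 0"
    and \<mu>_add: "\<And>x y. \<mu> (x + y) = \<mu> x + \<mu> y"
    and \<mu>_mult: "\<And>c a. \<mu> (c * a ^ CHAR('r)) = \<mu> c * a"
    and rel: "(\<Sum>j\<in>I. \<iota> (c j) * g j ^ CHAR('r)) = 0"
  shows "(\<Sum>j\<in>I. \<iota> (\<mu> (c j)) * g j) = 0"
proof (cases "finite I")
  case True
  have prime: "prime CHAR('r)" using p prime_CHAR_semidom[where 'a = 'k] by (simp add: CHAR_eq)
  have "\<mu> 0 + \<mu> 0 = \<mu> 0 + 0"
    using \<mu>_add[of 0 0] by (simp only: add_0_right)
  hence \<mu>_0: "\<mu> 0 = 0" by (simp only: add_left_cancel)
  have \<mu>_sum: "\<mu> (sum f A) = (\<Sum>x\<in>A. \<mu> (f x))" for f and A :: "'x set"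
    by (induction A rule: infinite_finite_induct) (auto simp: \<mu>_0 \<mu>_add)
  have main: "(\<Sum>j\<in>I. \<iota> (\<mu> (c j)) * g j) = 0"
    if "\<And>j. j \<in> I \<Longrightarrow> g j \<in> degree_le k" "(\<Sum>j\<in>I. \<iota> (c j) * g j ^ CHAR('r)) = 0" for g k
    using that
  proof (induction k arbitrary: g rule: less_induct)
    case (less k)
    let ?y = "\<Sum>j\<in>I. \<iota> (\<mu> (c j)) * g j"
    have "H i n ?y = 0" if "n > 0" for i n
    proof -
      have "(\<Sum>j\<in>I. \<iota> (c j) * H i n (g j) ^ CHAR('r)) =
          H i (n * CHAR('r)) (\<Sum>j\<in>I. \<iota> (c j) * g j ^ CHAR('r))"
        using p by (simp add: H_sum H_scale H_CHAR_power)
      also have "\<dots> = 0" by (simp add: less.prems)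
      finally have rel': "(\<Sum>j\<in>I. \<iota> (c j) * H i n (g j) ^ CHAR('r)) = 0" .
      have "H i n ?y = (\<Sum>j\<in>I. \<iota> (\<mu> (c j)) * H i n (g j))"
        by (simp add: H_sum H_scale)
      also have "\<dots> = 0"
      proof (cases "k = 0")
        case True
        hence "H i n (g j) = 0" if "j \<in> I" for j
          using H_degree_le[OF less.prems(1)[OF that] \<open>n > 0\<close>, of i] by simp
        thus ?thesis by simp
      next
        case False
        have "H i n (g j) \<in> degree_le (k - 1)" if "j \<in> I" for j
          using H_degree_le[OF less.prems(1)[OF that] \<open>n > 0\<close>, of i]
            R_subset_degree_le[OF R_zero, of 0] by auto
        thus ?thesis using less.IH[of "k - 1"] rel' False by simp
      qed
      finally show ?thesis .
    qed
    then obtain b where b: "?y = \<iota> b" using enough by blast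
    have "\<forall>j. \<exists>c y. g j = \<iota> c + y \<and> y \<in> vs.span homogeneous_pos"
      using const_plus_pos by blast
    hence "\<exists>a y. \<forall>j. g j = \<iota> (a j) + y j \<and> y j \<in> vs.span homogeneous_pos"
      by (simp only: choice_iff)
    then obtain a y where
      a: "\<And>j. g j = \<iota> (a j) + y j" "\<And>j. y j \<in> vs.span homogeneous_pos"
      by (elim exE) auto
    have "g j ^ CHAR('r) = \<iota> (a j ^ CHAR('r)) + y j ^ CHAR('r)" for j
      by (simp add: a freshmans_dream[OF prime refl] \<iota>_power)
    hence "0 = \<iota> (\<Sum>j\<in>I. c j * a j ^ CHAR('r)) + (\<Sum>j\<in>I. \<iota> (c j) * y j ^ CHAR('r))"
      using less.prems(2) by (simp add: distrib_left sum.distrib \<iota>_sum \<iota>_mult)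
    moreover have "y j ^ CHAR('r) \<in> vs.span homogeneous_pos" for j
      using span_pos_power[OF a(2)] prime_ge_2_nat[OF prime] span_decomposables_subset by blast
    hence "(\<Sum>j\<in>I. \<iota> (c j) * y j ^ CHAR('r)) \<in> vs.span homogeneous_pos"
      by (intro vs.span_sum vs.span_scale)
    ultimately have "- \<iota> (\<Sum>j\<in>I. c j * a j ^ CHAR('r)) \<in> vs.span homogeneous_pos"
      by (metis add_eq_0_iff)
    hence "\<iota> (\<Sum>j\<in>I. c j * a j ^ CHAR('r)) \<in> vs.span homogeneous_pos"
      using vs.span_neg by fastforce
    hence 0: "(\<Sum>j\<in>I. c j * a j ^ CHAR('r)) = 0" by (rule span_pos_const)
    have "?y = \<iota> (\<Sum>j\<in>I. \<mu> (c j) * a j) + (\<Sum>j\<in>I. \<iota> (\<mu> (c j)) * y j)"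
      by (simp add: a(1) distrib_left sum.distrib \<iota>_sum \<iota>_mult)
    also have "(\<Sum>j\<in>I. \<mu> (c j) * a j) = \<mu> (\<Sum>j\<in>I. c j * a j ^ CHAR('r))"
      by (simp add: \<mu>_sum \<mu>_mult)
    finally have "?y = (\<Sum>j\<in>I. \<iota> (\<mu> (c j)) * y j)" by (simp add: 0 \<mu>_0)
    moreover have "(\<Sum>j\<in>I. \<iota> (\<mu> (c j)) * y j) \<in> vs.span homogeneous_pos"
      by (intro vs.span_sum vs.span_scale a)
    ultimately have "\<iota> b \<in> vs.span homogeneous_pos" using b by simp
    hence "b = 0" by (rule span_pos_const)
    thus ?case using b by simp
  qed
  define k where "k j = (SOME k. g j \<in> degree_le k)" for j
  have k: "g j \<in> degree_le (k j)" for j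
    unfolding k_def by (rule someI_ex) (rule degree_le_exhaustive)
  have "g j \<in> degree_le (Max (k ` I))" if "j \<in> I" for j
  proof -
    have "degree_le (k j) \<subseteq> degree_le (Max (k ` I))"
      unfolding degree_le_def
    proof (intro hull_mono UN_mono)
      have "k j \<le> Max (k ` I)" using that True by (intro Max_ge) auto
      thus "{..k j} \<subseteq> {..Max (k ` I)}" by simp
    qed simp
    thus ?thesis using k by blast
  qed
  thus ?thesis using main rel by blast
qed simp

context
  fixes E :: "'r set" and deg :: "'r \<Rightarrow> nat"
  assumes E_deg: "\<And>e. e \<in> E \<Longrightarrow> 0 < deg e \<and> e \<in> R (deg e)"
    and E_minimal: "\<And>e. e \<in> E \<Longrightarrow> e \<notin> vs.span (decomposables \<union> (E - {e}))"
    and E_generates: "\<And>x d. x \<in> R d \<Longrightarrow> x \<in> adjoin {e \<in> E. deg e \<le> d}"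
begin

text \<open>Induction on the set of generators that occur, split off a generator \<open>x\<close> of largest degree: the
  relation becomes one between powers of \<open>x\<close> whose coefficients are polynomials in other generators of
  at most the same degree, as \<open>power_independent\<close> requires.\<close>

lemma reduced_monomials_independent:
  assumes "finite F" "F \<subseteq> E"
    and "finite I" "inj_on mon I"
    and "\<And>j. j \<in> I \<Longrightarrow> Poly_Mapping.keys (mon j) \<subseteq> F"
    and "\<And>j v. j \<in> I \<Longrightarrow> CHAR('r) = 0 \<or> Poly_Mapping.lookup (mon j) v < CHAR('r)"
    and "\<And>j. j \<in> I \<Longrightarrow> q j \<in> adjoin CHAR_powers"
    and "(\<Sum>j\<in>I. q j * monom_value (mon j)) = 0"
    and "j \<in> I"
  shows "q j = 0"
  using assms
proof (induction F arbitrary: I mon j rule: finite_ranking_induct[where f = deg])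
  case empty
  have mon: "mon i = 0" if "i \<in> I" for i using empty.prems(4)[OF that] by simp
  hence "i = j" if "i \<in> I" for i
    using inj_onD[OF empty.prems(3), of i j] empty.prems(8) that by simp
  hence "I = {j}" using empty.prems(8) by blast
  thus ?case using empty.prems(7) mon[of j] by simp
next
  case (insert x S I mon j)
  show ?case
  proof (cases "x \<in> S")
    case True
    hence "insert x S = S" by blast
    note prems = insert.prems[unfolded this]
    show ?thesis by (rule insert.IH[of I mon j]) (use prems in auto)
  next
    case False
    define X where "X = CHAR_powers \<union> ({e \<in> E. deg e \<le> deg x} - {x})"
    let ?l = "\<lambda>j. Poly_Mapping.lookup (mon j) x"
    let ?mon = "\<lambda>l j. mon j - Poly_Mapping.single x l"
    define n where "n = Max (?l ` I)"
    define a where "a l = (\<Sum>j\<in>{j \<in> I. ?l j = l}. q j * monom_value (?mon l j))" for l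
    have le_n: "?l j \<le> n" if "j \<in> I" for j
      using that \<open>finite I\<close> by (simp add: n_def)
    have keys: "Poly_Mapping.keys (?mon (?l j) j) \<subseteq> S" if "j \<in> I" for j
    proof
      fix v assume "v \<in> Poly_Mapping.keys (?mon (?l j) j)"
      hence "v \<noteq> x" "v \<in> Poly_Mapping.keys (mon j)"
        by (auto simp: in_keys_iff lookup_minus lookup_single when_def split: if_splits)
      thus "v \<in> S" using insert.prems(4)[OF that] by blast
    qed
    have "(\<Sum>l\<le>n. a l * x ^ l) = (\<Sum>l\<le>n. \<Sum>j\<in>{j \<in> I. ?l j = l}. q j * monom_value (mon j))"
      unfolding a_def sum_distrib_right
      by (intro sum.cong refl) (auto simp: monom_value_split[of "mon _" x] mult.assoc)
    also have "\<dots> = (\<Sum>j\<in>I. q j * monom_value (mon j))"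
      using \<open>finite I\<close> le_n by (intro sum.group) auto
    finally have rel: "(\<Sum>l\<le>n. a l * x ^ l) = 0" using insert.prems(7) by simp
    have "a l \<in> adjoin X" for l
    proof -
      have "q j * monom_value (?mon l j) \<in> adjoin X" if "j \<in> I" "?l j = l" for j
      proof (rule adjoin_mult)
        have "adjoin CHAR_powers \<subseteq> adjoin X" by (intro hull_mono) (auto simp: X_def)
        thus "q j \<in> adjoin X" using insert.prems(6) that by blast
        have "S \<subseteq> X" using insert.hyps(2) insert.prems(1) False by (auto simp: X_def)
        thus "monom_value (?mon l j) \<in> adjoin X"
          using keys[OF that(1)] that(2) unfolding monom_value_def
          by (intro adjoin_prod adjoin_power hull_inc) auto
      qed
      thus ?thesis unfolding a_def by (intro adjoin_sum) auto
    qed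
    moreover have "CHAR('r) = 0 \<or> n < CHAR('r)"
    proof -
      have "n \<in> ?l ` I" unfolding n_def using \<open>finite I\<close> \<open>j \<in> I\<close> by (intro Max_in) auto
      thus ?thesis using insert.prems(5) by auto
    qed
    ultimately have "a (?l j) = 0"
      using power_independent[OF E_deg E_minimal E_generates _ X_def, of n a] rel insert.prems(1,8) le_n
      by auto
    hence sum0: "(\<Sum>i\<in>{i \<in> I. ?l i = ?l j}. q i * monom_value (?mon (?l j) i)) = 0"
      by (simp add: a_def)
    show ?thesis
    proof (rule insert.IH[of "{i \<in> I. ?l i = ?l j}" "?mon (?l j)" j])
      show "inj_on (?mon (?l j)) {i \<in> I. ?l i = ?l j}"
      proof (rule inj_onI)
        fix i i' assume i: "i \<in> {i \<in> I. ?l i = ?l j}" "i' \<in> {i \<in> I. ?l i = ?l j}"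
          and eq: "?mon (?l j) i = ?mon (?l j) i'"
        have "mon i = mon i'"
        proof (rule poly_mapping_eqI)
          fix v
          show "Poly_Mapping.lookup (mon i) v = Poly_Mapping.lookup (mon i') v"
            using i arg_cong[OF eq, of "\<lambda>m. Poly_Mapping.lookup m v"]
            by (cases "v = x") (auto simp: lookup_minus lookup_single when_def)
        qed
        thus "i = i'" using insert.prems(3) i by (auto dest: inj_onD)
      qed
      show "CHAR('r) = 0 \<or> Poly_Mapping.lookup (?mon (?l j) i) v < CHAR('r)"
        if "i \<in> {i \<in> I. ?l i = ?l j}" for i v
        using insert.prems(5)[of i v] that by (auto simp: lookup_minus)
      show "Poly_Mapping.keys (?mon (?l j) i) \<subseteq> S" if "i \<in> {i \<in> I. ?l i = ?l j}" for i
        using keys[of i] that by auto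
    qed (use insert.prems sum0 in auto)
  qed
qed

text \<open>Collect the monomials according to their remainders modulo \<open>p\<close>. The coefficients of the reduced
  monomials are sums of \<open>p\<close>-th powers of monomials, up to constants, and they vanish. In characteristic
  zero each of these sums has a single term; otherwise the descent gives a relation whose degree is at
  most half as large. After division by \<open>c j\<close> the splitting maps the coefficient at \<open>j\<close> to \<open>1\<close>, so
  that the new relation is nontrivial if \<open>c j \<noteq> 0\<close>.\<close>

lemma monomials_independent:
  assumes "finite I" "inj_on mon I"
    and "\<And>j. j \<in> I \<Longrightarrow> Poly_Mapping.keys (mon j) \<subseteq> E"
    and "\<And>j. j \<in> I \<Longrightarrow> mono_degree (mon j) \<le> d"
    and "(\<Sum>j\<in>I. \<iota> (c j) * monom_value (mon j)) = 0"
    and "j \<in> I"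
  shows "c j = 0"
  using assms
proof (induction d arbitrary: I mon c j rule: less_induct)
  case (less d I mon c j)
  let ?p = "CHAR('r)"
  let ?q = "\<lambda>j. div_monom (mon j) ?p" and ?r = "\<lambda>j. mod_monom (mon j) ?p"
  define Q where "Q \<rho> = (\<Sum>j\<in>{j \<in> I. ?r j = \<rho>}. \<iota> (c j) * monom_value (?q j) ^ ?p)" for \<rho>
  have "(\<Sum>\<rho>\<in>?r ` I. Q \<rho> * monom_value \<rho>) =
      (\<Sum>\<rho>\<in>?r ` I. \<Sum>j\<in>{j \<in> I. ?r j = \<rho>}. \<iota> (c j) * monom_value (mon j))"
    unfolding Q_def sum_distrib_right
    by (intro sum.cong refl) (auto simp: monom_value_div_mod[of "mon _" ?p] mult.assoc)
  also have "\<dots> = (\<Sum>j\<in>I. \<iota> (c j) * monom_value (mon j))"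
    using less.prems(1) by (intro sum.group) auto
  finally have rel: "(\<Sum>\<rho>\<in>?r ` I. Q \<rho> * monom_value \<rho>) = 0" using less.prems(5) by simp
  have "Q (?r j) = 0"
  proof (rule reduced_monomials_independent[of "\<Union>i\<in>I. Poly_Mapping.keys (mon i)" "?r ` I" "\<lambda>m. m"])
    show "Q \<rho> \<in> adjoin CHAR_powers" for \<rho>
      unfolding Q_def by (intro adjoin_sum adjoin_mult adjoin_const hull_inc) auto
    show "Poly_Mapping.keys \<rho> \<subseteq> (\<Union>i\<in>I. Poly_Mapping.keys (mon i))" if "\<rho> \<in> ?r ` I" for \<rho>
      using that keys_mod_monom by fast
    show "?p = 0 \<or> Poly_Mapping.lookup \<rho> v < ?p" if "\<rho> \<in> ?r ` I" for \<rho> v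
      using that by (cases "?p = 0") (auto simp: lookup_mod_monom)
  qed (use less.prems rel in auto)
  hence rel': "(\<Sum>i\<in>{i \<in> I. ?r i = ?r j}. \<iota> (c i) * monom_value (?q i) ^ ?p) = 0"
    by (simp add: Q_def)
  consider "?p = 0" | "d = 0" | "?p > 0" "d > 0" by blast
  thus ?case
  proof cases
    case 1
    have "?r i = mon i" for i
      by (rule poly_mapping_eqI) (simp add: 1 lookup_mod_monom)
    hence "{i \<in> I. ?r i = ?r j} = {j}"
      using less.prems(2,6) by (auto dest: inj_onD)
    thus ?thesis using rel' by (simp add: 1)
  next
    case 2
    hence mon: "mon i = 0" if "i \<in> I" for i
      using less.prems(4)[OF that] mono_degree_eq_0 by simp
    hence "i = j" if "i \<in> I" for i
      using inj_onD[OF less.prems(2), of i j] less.prems(6) that by simp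
    hence "I = {j}" using less.prems(6) by blast
    thus ?thesis using less.prems(5) mon[of j] by simp
  next
    case 3
    let ?J = "{i \<in> I. ?r i = ?r j}"
    from exists_frobenius_splitting[OF 3(1)[unfolded CHAR_eq]]
    obtain \<mu> :: "'k \<Rightarrow> 'k" where "(\<forall>x y. \<mu> (x + y) = \<mu> x + \<mu> y) \<and>
      (\<forall>c a. \<mu> (c * a ^ CHAR('k)) = \<mu> c * a) \<and> \<mu> 1 = 1"
      by (elim exE) (rule that)
    hence \<mu>: "\<And>x y. \<mu> (x + y) = \<mu> x + \<mu> y"
      "\<And>c a. \<mu> (c * a ^ ?p) = \<mu> c * a" "\<mu> 1 = 1"
      by (simp_all add: CHAR_eq)
    show ?thesis
    proof (rule ccontr)
      assume nz: "c j \<noteq> 0"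
      have "(\<Sum>i\<in>?J. \<iota> (c i / c j) * monom_value (?q i) ^ ?p) =
          \<iota> (inverse (c j)) * (\<Sum>i\<in>?J. \<iota> (c i) * monom_value (?q i) ^ ?p)"
        unfolding sum_distrib_left
        by (intro sum.cong refl) (simp only: divide_inverse \<iota>_mult mult_ac)
      hence "(\<Sum>i\<in>?J. \<iota> (c i / c j) * monom_value (?q i) ^ ?p) = 0"
        by (simp only: rel' mult_zero_right)
      from frobenius_splitting_relation[OF 3(1) \<mu>(1,2) this]
      have rel'': "(\<Sum>i\<in>?J. \<iota> (\<mu> (c i / c j)) * monom_value (?q i)) = 0" .
      have "\<mu> (c j / c j) = 0"
      proof (rule less.IH[of "d div 2" ?J ?q "\<lambda>i. \<mu> (c i / c j)" j])
        show "d div 2 < d" using 3 by simp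
        show "inj_on ?q ?J"
        proof (rule inj_onI)
          fix i i' assume i: "i \<in> ?J" "i' \<in> ?J" "?q i = ?q i'"
          hence "mon i = mon i'" by (intro div_mod_monom_inject[of "mon i" ?p "mon i'"]) simp_all
          thus "i = i'" using inj_onD[OF less.prems(2)] i by blast
        qed
        show "mono_degree (?q i) \<le> d div 2" if "i \<in> ?J" for i
        proof -
          have "2 \<le> ?p"
            using prime_ge_2_nat[OF prime_CHAR_semidom[OF 3(1)[unfolded CHAR_eq]]]
            by (simp only: CHAR_eq)
          hence "mono_degree (?q i) * 2 \<le> mono_degree (?q i) * ?p" by (rule mult_le_mono2)
          also have "\<dots> \<le> d"
            using mono_degree_div_monom[of "mon i" ?p] less.prems(4)[of i] that by simp
          finally show ?thesis by simp
        qed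
        show "Poly_Mapping.keys (?q i) \<subseteq> E" if "i \<in> ?J" for i
          using less.prems(3)[of i] that keys_div_monom by fast
      qed (use less.prems rel'' in auto)
      thus False using \<mu>(3) nz by simp
    qed
  qed
qed

lemma minimal_generators_independent: "alg_independent \<iota> E"
  unfolding alg_independent_def
proof (intro ballI impI)
  fix P :: "('r \<Rightarrow>\<^sub>0 nat) \<Rightarrow>\<^sub>0 'k"
  assume P: "P \<in> polys_in E" "poly_eval \<iota> (\<lambda>x. x) P = 0"
  let ?K = "Poly_Mapping.keys P"
  have "Poly_Mapping.lookup P m = 0" if "m \<in> ?K" for m
  proof (rule monomials_independent[of ?K "\<lambda>m. m" "Max (mono_degree ` ?K)"])
    show "(\<Sum>m\<in>?K. \<iota> (Poly_Mapping.lookup P m) * monom_value m) = 0"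
      using P(2) by (simp add: poly_eval_def monom_value_def)
  qed (use P(1) that in \<open>auto simp: polys_in_def\<close>)
  thus "P = 0" by (metis in_keys_iff lookup_zero poly_mapping_eqI)
qed

end

theorem polynomial_if_enough_hasse: "polynomial_graded_algebra \<iota> R"
proof -
  from exists_minimal_generators obtain E deg where
    gen: "(\<forall>e\<in>E. 0 < deg e \<and> e \<in> R (deg e)) \<and>
      (\<forall>e\<in>E. e \<notin> vs.span (decomposables \<union> (E - {e}))) \<and>
      (\<forall>d. \<forall>x\<in>R d. x \<in> adjoin {e \<in> E. deg e \<le> d})"
    by (elim exE)
  have E: "\<And>e. e \<in> E \<Longrightarrow> 0 < deg e \<and> e \<in> R (deg e)"
    "\<And>e. e \<in> E \<Longrightarrow> e \<notin> vs.span (decomposables \<union> (E - {e}))"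
    "\<And>x d. x \<in> R d \<Longrightarrow> x \<in> adjoin {e \<in> E. deg e \<le> d}"
    using gen by auto
  have "x \<in> adjoin E" if "x \<in> R d" for x d
    using E(3)[OF that] hull_mono[of "{e \<in> E. deg e \<le> d}" E "subalgebra \<iota>"] by blast
  hence "generates_algebra \<iota> E"
    unfolding generates_algebra_def by (rule adjoin_homogeneous_eq_UNIV)
  moreover have "inj \<iota>"
  proof (rule injI)
    fix a b assume "\<iota> a = \<iota> b"
    hence "\<iota> (a + - b) = 0" by (simp only: \<iota>_add \<iota>_uminus) simp
    thus "a = b" by simp
  qed
  hence "bij_betw \<iota> UNIV (R 0)" by (simp add: bij_betw_def R_0)
  ultimately show ?thesis
    using E(1) minimal_generators_independent[OF E] hom grading
    unfolding polynomial_graded_algebra_def by blast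
qed

end


section \<open>Divided partial derivatives on the inverse limit\<close>

lemma poly_mapping_additive_induct [case_names zero single add]:
  fixes p :: "'x \<Rightarrow>\<^sub>0 'a::comm_monoid_add"
  assumes "P 0" "\<And>m a. P (Poly_Mapping.single m a)" "\<And>p q. P p \<Longrightarrow> P q \<Longrightarrow> P (p + q)"
  shows "P p"
proof -
  have "P (\<Sum>m\<in>M. Poly_Mapping.single m (Poly_Mapping.lookup p m))" for M
    by (induction M rule: infinite_finite_induct) (auto intro: assms)
  moreover have "p = (\<Sum>m\<in>Poly_Mapping.keys p. Poly_Mapping.single m (Poly_Mapping.lookup p m))"
    by (rule poly_mapping_eqI)
      (simp add: lookup_sum lookup_single when_def in_keys_iff)
  ultimately show ?thesis by metis
qed

text \<open>The operator \<open>(1/n!) (\<partial>/\<partial>x\<^sub>i)\<^sup>n\<close>, which maps \<open>x\<^sub>i\<^bsup>k+n\<^esup>\<close> to \<open>(k + n choose n) x\<^sub>i\<^sup>k\<close>.\<close>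

lift_definition hasse_poly ::
  "'u \<Rightarrow> nat \<Rightarrow> (('u \<Rightarrow>\<^sub>0 nat) \<Rightarrow>\<^sub>0 'a::comm_ring_1) \<Rightarrow> (('u \<Rightarrow>\<^sub>0 nat) \<Rightarrow>\<^sub>0 'a)"
  is "\<lambda>i n p e. of_nat ((Poly_Mapping.lookup e i + n) choose n) * p (e + Poly_Mapping.single i n)"
proof -
  fix i :: 'u and n and p :: "('u \<Rightarrow>\<^sub>0 nat) \<Rightarrow> 'a"
  assume "finite {m. p m \<noteq> 0}"
  hence "finite ((\<lambda>e. e + Poly_Mapping.single i n) -` {m. p m \<noteq> 0})"
    by (rule finite_vimageI) (simp add: inj_def)
  thus "finite {e. of_nat ((Poly_Mapping.lookup e i + n) choose n) *
      p (e + Poly_Mapping.single i n) \<noteq> 0}"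
    by (rule rev_finite_subset) auto
qed

lemma lookup_hasse_poly:
  "Poly_Mapping.lookup (hasse_poly i n p) e =
     of_nat ((Poly_Mapping.lookup e i + n) choose n) *
     Poly_Mapping.lookup p (e + Poly_Mapping.single i n)"
  by transfer simp

lemma hasse_poly_0: "hasse_poly i n 0 = 0"
  and hasse_poly_add: "hasse_poly i n (p + q) = hasse_poly i n p + hasse_poly i n q"
  by (auto intro!: poly_mapping_eqI simp: lookup_hasse_poly lookup_add distrib_left)

lemma hasse_poly_single:
  "hasse_poly i n (Poly_Mapping.single m a) =
     Poly_Mapping.single (m - Poly_Mapping.single i n) (of_nat (Poly_Mapping.lookup m i choose n) * a)"
proof (rule poly_mapping_eqI)
  fix e
  show "Poly_Mapping.lookup (hasse_poly i n (Poly_Mapping.single m a)) e =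
    Poly_Mapping.lookup (Poly_Mapping.single (m - Poly_Mapping.single i n)
      (of_nat (Poly_Mapping.lookup m i choose n) * a)) e"
  proof (cases "n \<le> Poly_Mapping.lookup m i")
    case True
    have "m - Poly_Mapping.single i n + Poly_Mapping.single i n = m"
      using True by (intro poly_mapping_eqI) (auto simp: lookup_add lookup_minus lookup_single when_def)
    hence "m = e + Poly_Mapping.single i n \<longleftrightarrow> m - Poly_Mapping.single i n = e" by auto
    moreover have "Poly_Mapping.lookup (e + Poly_Mapping.single i n) i = Poly_Mapping.lookup e i + n"
      by (simp add: lookup_add)
    ultimately show ?thesis
      by (auto simp: lookup_hasse_poly lookup_single when_def)
  next
    case False
    hence "m \<noteq> e + Poly_Mapping.single i n" by (auto simp: lookup_add)
    moreover have "Poly_Mapping.lookup m i choose n = 0" using False by simp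
    ultimately show ?thesis
      by (simp add: lookup_hasse_poly lookup_single when_def del: binomial_eq_0_iff)
  qed
qed

text \<open>On monomials the Leibniz rule is Vandermonde's identity for binomial coefficients.\<close>

lemma hasse_poly_mult:
  fixes p q :: "('u \<Rightarrow>\<^sub>0 nat) \<Rightarrow>\<^sub>0 'a::comm_ring_1"
  shows "hasse_poly i n (p * q) = (\<Sum>j\<le>n. hasse_poly i j p * hasse_poly i (n - j) q)"
proof (induction p rule: poly_mapping_additive_induct)
  case (single m a)
  show ?case
  proof (induction q rule: poly_mapping_additive_induct)
    case (single m' b)
    let ?s = "Poly_Mapping.single i" and ?l = "\<lambda>m. Poly_Mapping.lookup m i"
    have "Poly_Mapping.single (m - ?s j + (m' - ?s (n - j)))
          (of_nat (?l m choose j) * a * (of_nat (?l m' choose (n - j)) * b)) =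
        Poly_Mapping.single (m + m' - ?s n)
          (of_nat ((?l m choose j) * (?l m' choose (n - j))) * (a * b))" if "j \<le> n" for j
    proof (cases "j \<le> ?l m \<and> n - j \<le> ?l m'")
      case True
      hence "m - ?s j + (m' - ?s (n - j)) = m + m' - ?s n"
        using that by (intro poly_mapping_eqI) (auto simp: lookup_add lookup_minus lookup_single when_def)
      thus ?thesis by (simp add: mult_ac)
    next
      case False
      hence "(?l m choose j) = 0 \<or> (?l m' choose (n - j)) = 0" by auto
      thus ?thesis by (elim disjE) (simp_all del: binomial_eq_0_iff)
    qed
    hence "(\<Sum>j\<le>n. hasse_poly i j (Poly_Mapping.single m a) * hasse_poly i (n - j) (Poly_Mapping.single m' b)) =
      (\<Sum>j\<le>n. Poly_Mapping.single (m + m' - ?s n)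
          (of_nat ((?l m choose j) * (?l m' choose (n - j))) * (a * b)))"
      by (intro sum.cong) (auto simp: hasse_poly_single mult_single)
    also have "\<dots> = Poly_Mapping.single (m + m' - ?s n)
        (\<Sum>j\<le>n. of_nat ((?l m choose j) * (?l m' choose (n - j))) * (a * b))"
      by (intro poly_mapping_eqI) (simp add: lookup_sum lookup_single when_def)
    also have "(\<Sum>j\<le>n. of_nat ((?l m choose j) * (?l m' choose (n - j))) * (a * b)) =
        of_nat ((?l m + ?l m') choose n) * (a * b)"
      unfolding vandermonde[symmetric] of_nat_sum sum_distrib_right ..
    finally show ?case by (simp add: hasse_poly_single mult_single lookup_add)
  qed (simp_all add: hasse_poly_0 hasse_poly_add distrib_left sum.distrib)
qed (simp_all add: hasse_poly_0 hasse_poly_add distrib_right sum.distrib)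

lemma mono_degree_single: "mono_degree (Poly_Mapping.single i n) = n"
  by (simp add: mono_degree_def)

text \<open>The component at \<open>V\<close> may need the variable \<open>x\<^sub>i\<close> even if it is not in \<open>V\<close>: the derivative of \<open>x\<^sub>i m\<close>
  can be a monomial in the variables of \<open>V\<close>. Therefore the derivative is taken in \<open>V \<union> {i}\<close> and then
  restricted.\<close>

lift_definition hasse_lim ::
  "'u \<Rightarrow> nat \<Rightarrow> ('u, 'a::comm_ring_1) graded_lim \<Rightarrow> ('u, 'a) graded_lim"
  is "\<lambda>i n F V. kill_vars (fset V) (hasse_poly i n (F (finsert i V)))"
proof (intro CollectI conjI; elim CollectE conjE)
  fix i :: 'u and n and F :: "'u fset \<Rightarrow> (('u \<Rightarrow>\<^sub>0 nat) \<Rightarrow>\<^sub>0 'a)"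
  let ?F = "\<lambda>V. kill_vars (fset V) (hasse_poly i n (F (finsert i V)))"
  assume compat: "\<forall>V W. V |\<subseteq>| W \<longrightarrow> kill_vars (fset V) (F W) = F V"
    and bounded: "\<exists>d. \<forall>V. \<forall>m\<in>Poly_Mapping.keys (F V). mono_degree m \<le> d"
  show "\<forall>V. ?F V \<in> polys_in (fset V)"
  proof
    fix V
    have "Poly_Mapping.keys m \<subseteq> fset V" if "m \<in> Poly_Mapping.keys (?F V)" for m
      using that by (simp add: in_keys_iff[of m] lookup_kill_vars when_def split: if_splits)
    thus "?F V \<in> polys_in (fset V)" by (auto simp: polys_in_def)
  qed
  show "\<forall>V W. V |\<subseteq>| W \<longrightarrow> kill_vars (fset V) (?F W) = ?F V"
  proof (intro allI impI)
    fix V W :: "'u fset" assume VW: "V |\<subseteq>| W"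
    hence "F (finsert i V) = kill_vars (fset (finsert i V)) (F (finsert i W))"
      using compat by (metis finsert_mono)
    thus "kill_vars (fset V) (?F W) = ?F V"
      using VW by (intro poly_mapping_eqI)
        (auto simp: lookup_kill_vars lookup_hasse_poly when_def keys_add_nat less_eq_fset.rep_eq
          split: if_splits)
  qed
  obtain d where d: "\<And>V m. m \<in> Poly_Mapping.keys (F V) \<Longrightarrow> mono_degree m \<le> d"
    using bounded by blast
  have "mono_degree m \<le> d" if "m \<in> Poly_Mapping.keys (?F V)" for V m
  proof -
    have "m + Poly_Mapping.single i n \<in> Poly_Mapping.keys (F (finsert i V))"
      using that by (auto simp: in_keys_iff lookup_kill_vars lookup_hasse_poly when_def split: if_splits)
    from d[OF this] show ?thesis by (simp add: mono_degree_add)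
  qed
  thus "\<exists>d. \<forall>V. \<forall>m\<in>Poly_Mapping.keys (?F V). mono_degree m \<le> d" by blast
qed

lemma graded_lim_coeff_hasse_lim:
  "graded_lim_coeff (hasse_lim i n F) e =
     of_nat ((Poly_Mapping.lookup e i + n) choose n) * graded_lim_coeff F (e + Poly_Mapping.single i n)"
  unfolding graded_lim_coeff_def[of "hasse_lim i n F"]
  by (simp add: hasse_lim.rep_eq lookup_kill_vars lookup_hasse_poly Abs_fset_inverse
      lookup_component keys_add_nat when_def subset_insertI2 subset_insertI)

lemma component_sum: "component (sum f A) V = (\<Sum>x\<in>A. component (f x) V)"
  by (induction A rule: infinite_finite_induct)
    (auto simp: zero_graded_lim.rep_eq plus_graded_lim.rep_eq)

lemma kill_vars_sum: "kill_vars V (sum f A) = (\<Sum>x\<in>A. kill_vars V (f x))"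
  by (induction A rule: infinite_finite_induct) (auto simp: kill_vars_0 kill_vars_add)

lemma hasse_lim_mult:
  "hasse_lim i n (F * G) = (\<Sum>j\<le>n. hasse_lim i j F * hasse_lim i (n - j) G)"
proof -
  have "component (hasse_lim i n (F * G)) = component (\<Sum>j\<le>n. hasse_lim i j F * hasse_lim i (n - j) G)"
    by (rule ext)
      (simp add: hasse_lim.rep_eq times_graded_lim.rep_eq hasse_poly_mult component_sum
        kill_vars_sum kill_vars_mult)
  thus ?thesis by (simp add: component_inject)
qed

lemma graded_lim_eqI: "(\<And>m. graded_lim_coeff F m = graded_lim_coeff G m) \<Longrightarrow> F = G"
  by (subst component_inject[symmetric]) (auto intro!: ext poly_mapping_eqI simp: lookup_component)

lemma graded_lim_coeff_0 [simp]: "graded_lim_coeff 0 m = 0"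
  and graded_lim_coeff_add: "graded_lim_coeff (F + G) m = graded_lim_coeff F m + graded_lim_coeff G m"
  by (simp_all add: graded_lim_coeff_def zero_graded_lim.rep_eq plus_graded_lim.rep_eq lookup_add)

lemma graded_lim_coeff_1: "graded_lim_coeff 1 m = (1 when m = 0)"
  by (simp add: graded_lim_coeff_def one_graded_lim.rep_eq lookup_one)

lemma graded_lim_coeff_scale: "graded_lim_coeff (graded_lim_const a * F) m = a * graded_lim_coeff F m"
  by (simp add: graded_lim_coeff_def times_graded_lim.rep_eq graded_lim_const.rep_eq
      flip: mult_map_scale_conv_mult) (simp add: Poly_Mapping.map.rep_eq when_def)

lemma graded_lim_piece_iff:
  "F \<in> graded_lim_piece d \<longleftrightarrow> (\<forall>m. graded_lim_coeff F m \<noteq> 0 \<longrightarrow> mono_degree m = d)"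
proof
  assume "F \<in> graded_lim_piece d"
  thus "\<forall>m. graded_lim_coeff F m \<noteq> 0 \<longrightarrow> mono_degree m = d"
    using bij_betw_graded_lim_coeff[of d] by (auto simp: bij_betw_def)
qed (auto simp: graded_lim_piece_def in_keys_iff lookup_component when_def split: if_splits)

lemma graded_lim_bounded: "\<exists>d. \<forall>m. graded_lim_coeff F m \<noteq> 0 \<longrightarrow> mono_degree m \<le> d"
proof -
  obtain d where "\<And>V m. m \<in> Poly_Mapping.keys (component F V) \<Longrightarrow> mono_degree m \<le> d"
    using component[of F] by blast
  thus ?thesis by (auto simp: graded_lim_coeff_def in_keys_iff)
qed

lemma graded_lim_piece_mult:
  assumes "F \<in> graded_lim_piece i" "G \<in> graded_lim_piece j"
  shows "F * G \<in> graded_lim_piece (i + j)"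
  unfolding graded_lim_piece_def
proof (intro CollectI allI ballI)
  fix V m assume "m \<in> Poly_Mapping.keys (component (F * G) V)"
  hence "m \<in> {a + b | a b. a \<in> Poly_Mapping.keys (component F V) \<and> b \<in> Poly_Mapping.keys (component G V)}"
    using keys_mult[of "component F V" "component G V"] by (auto simp: times_graded_lim.rep_eq)
  thus "mono_degree m = i + j"
    using assms by (auto simp: graded_lim_piece_def mono_degree_add)
qed

lemma exists_graded_lim_part:
  "\<exists>G. \<forall>m. graded_lim_coeff G m = (graded_lim_coeff F m when mono_degree m = d)"
proof -
  have "(\<lambda>m. graded_lim_coeff F m when mono_degree m = d) \<in>
      {c. \<forall>m. c m \<noteq> 0 \<longrightarrow> mono_degree m = d}"
    by (auto simp: when_def)
  also have "\<dots> = graded_lim_coeff ` graded_lim_piece d"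
    by (rule bij_betw_imp_surj_on[OF bij_betw_graded_lim_coeff, symmetric])
  finally obtain G where "(\<lambda>m. graded_lim_coeff F m when mono_degree m = d) = graded_lim_coeff G"
    by blast
  thus ?thesis by (metis (no_types, lifting))
qed


section \<open>Coefficients and Hasse derivations on \<open>K \<otimes>\<^sub>A A[[[x\<^sub>i]]]\<close>\<close>

lemma tensor_eqI:
  "free_tensor b c - x \<in> tensor_null to_fract graded_lim_const \<Longrightarrow> tensor b c = abs_rflat x"
  by (simp add: tensor_def rflat.abs_eq_iff tensor_eq_def)

lemma tensor_relations_null:
  "r \<in> tensor_relations to_fract graded_lim_const \<Longrightarrow> r \<in> tensor_null to_fract graded_lim_const"
  unfolding tensor_null_def by (rule hull_inc)

lemma tensor_add_left: "tensor (k + l) F = tensor k F + tensor l F"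
proof -
  have "free_tensor (k + l) F - free_tensor k F - free_tensor l F \<in>
      tensor_relations to_fract graded_lim_const"
    unfolding tensor_relations_def by blast
  from tensor_relations_null[OF this] show ?thesis
    unfolding diff_diff_eq by (subst tensor_eqI, assumption) (simp add: tensor_def plus_rflat.abs_eq)
qed

lemma tensor_add_right: "tensor k (F + G) = tensor k F + tensor k G"
proof -
  have "free_tensor k (F + G) - free_tensor k F - free_tensor k G \<in>
      tensor_relations to_fract graded_lim_const"
    unfolding tensor_relations_def by blast
  from tensor_relations_null[OF this] show ?thesis
    unfolding diff_diff_eq by (subst tensor_eqI, assumption) (simp add: tensor_def plus_rflat.abs_eq)
qed

lemma tensor_scale: "tensor (to_fract a * k) F = tensor k (graded_lim_const a * F)"
proof -
  have "free_tensor (to_fract a * k) F - free_tensor k (graded_lim_const a * F) \<in>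
      tensor_relations to_fract graded_lim_const"
    unfolding tensor_relations_def by blast
  from tensor_relations_null[OF this] show ?thesis
    by (subst tensor_eqI, assumption) (simp add: tensor_def)
qed

lemma tensor_mult: "tensor k F * tensor l G = tensor (k * l) (F * G)"
  by (simp add: tensor_def times_rflat.abs_eq mult_single)

lemma tensor_0_left [simp]: "tensor 0 F = 0"
  using tensor_add_left[of 0 0 F] by simp

lemma tensor_0_right [simp]: "tensor k 0 = 0"
  using tensor_add_right[of k 0 0] by simp

lemma tensor_uminus: "tensor (- k) F = - tensor k F"
  using tensor_add_left[of "- k" k F] by (simp add: eq_neg_iff_add_eq_0)

lemma tensor_1_1: "tensor 1 1 = 1"
  by (simp add: tensor_def one_rflat_def zero_pure_tensor_def flip: single_one)

text \<open>Every element is a pure tensor: as \<open>K = Frac A\<close>, the finitely many scalars have a common denominator.\<close>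

lemma rflat_cases:
  obtains k F where "y = tensor k F"
proof -
  define P where "P x \<longleftrightarrow> (\<exists>k F. abs_rflat x = tensor k F)"
    for x :: "('a fract, ('b, 'a) graded_lim) pure_tensor \<Rightarrow>\<^sub>0 int"
  have "P x" for x
  proof (rule frag_induction[where S = UNIV and P = P])
    show "P 0" unfolding P_def
      by (metis tensor_0_left zero_rflat_def)
    show "P (frag_of t)" for t
      unfolding P_def by (cases t) (auto simp: tensor_def)
    fix x x' assume "P x" "P x'"
    then obtain k F l G where x: "abs_rflat x = tensor k F" and x': "abs_rflat x' = tensor l G"
      by (auto simp: P_def)
    obtain a b where k: "k = Fract a b" "b \<noteq> 0" by (cases k)
    obtain c d where l: "- l = Fract c d" "d \<noteq> 0" by (cases "- l")
    have "abs_rflat (x - x') = abs_rflat x + - abs_rflat x'"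
      by (simp add: plus_rflat.abs_eq uminus_rflat.abs_eq)
    also have "\<dots> = tensor k F + tensor (- l) G" by (simp add: x x' tensor_uminus)
    also have "k = to_fract (a * d) * Fract 1 (b * d)" "- l = to_fract (c * b) * Fract 1 (b * d)"
      using k l by (simp_all add: to_fract_def eq_fract mult_ac)
    hence "tensor k F + tensor (- l) G =
        tensor (Fract 1 (b * d)) (graded_lim_const (a * d) * F + graded_lim_const (c * b) * G)"
      by (simp only: tensor_scale tensor_add_right)
    finally show "P (x - x')" unfolding P_def by blast
  qed simp
  from this[of "rep_rflat y"] obtain k F where "y = tensor k F"
    unfolding P_def by (auto simp: Quotient_abs_rep[OF Quotient_rflat])
  thus ?thesis by (rule that)
qed

text \<open>The coefficients of a series with coefficients in \<open>K\<close> are well-defined on the tensor product, and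
  they determine an element (\<open>rflat_eqI\<close>), since it is a pure tensor and \<open>A\<close> has no zero divisors. So the
  tensor product is the ring of series over \<open>K\<close> of bounded degree and with a common denominator.\<close>

definition free_coeff ::
  "('u \<Rightarrow>\<^sub>0 nat) \<Rightarrow> (('a::idom fract, ('u, 'a) graded_lim) pure_tensor \<Rightarrow>\<^sub>0 int) \<Rightarrow> 'a fract" where
  "free_coeff m x = (\<Sum>t\<in>Poly_Mapping.keys x. of_int (Poly_Mapping.lookup x t) *
     (case t of Pure_Tensor b c \<Rightarrow> b * to_fract (graded_lim_coeff c m)))"

lemma free_coeff_add: "free_coeff m (x + y) = free_coeff m x + free_coeff m y"
  unfolding free_coeff_def by (rule setsum_keys_plus_distrib) (simp_all add: distrib_right)

lemma free_coeff_uminus: "free_coeff m (- x) = - free_coeff m x"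
  unfolding free_coeff_def by (simp add: sum_negf keys_def)

lemma free_coeff_diff: "free_coeff m (x - y) = free_coeff m x - free_coeff m y"
  by (metis diff_conv_add_uminus free_coeff_add free_coeff_uminus)

lemma free_coeff_free: "free_coeff m (free_tensor b c) = b * to_fract (graded_lim_coeff c m)"
  by (simp add: free_coeff_def)

lemma free_coeff_null:
  assumes "x \<in> tensor_null to_fract graded_lim_const"
  shows "free_coeff m x = 0"
proof -
  have "add_subgroup {x. free_coeff m x = 0}"
    by (auto simp: add_subgroup_def free_coeff_add free_coeff_uminus) (simp add: free_coeff_def)
  moreover have "tensor_relations to_fract graded_lim_const \<subseteq> {x. free_coeff m x = 0}"
    by (auto simp: tensor_relations_def free_coeff_diff free_coeff_free graded_lim_coeff_add
        graded_lim_coeff_scale distrib_left distrib_right)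
  ultimately have "tensor_null to_fract graded_lim_const \<subseteq> {x. free_coeff m x = 0}"
    unfolding tensor_null_def by (intro hull_minimal)
  thus ?thesis using assms by blast
qed

lift_definition rflat_coeff :: "('u \<Rightarrow>\<^sub>0 nat) \<Rightarrow> ('u, 'a::idom) rflat \<Rightarrow> 'a fract" is free_coeff
proof -
  fix m and x y :: "('a fract, ('u, 'a) graded_lim) pure_tensor \<Rightarrow>\<^sub>0 int"
  assume "tensor_eq to_fract graded_lim_const x y"
  thus "free_coeff m x = free_coeff m y"
    using free_coeff_null[of "x - y" m] by (simp add: tensor_eq_def free_coeff_diff)
qed

lemma rflat_coeff_add: "rflat_coeff m (y + z) = rflat_coeff m y + rflat_coeff m z"
  by transfer (rule free_coeff_add)

lemma rflat_coeff_uminus: "rflat_coeff m (- y) = - rflat_coeff m y"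
  by transfer (rule free_coeff_uminus)

lemma rflat_coeff_diff: "rflat_coeff m (y - z) = rflat_coeff m y - rflat_coeff m z"
  using rflat_coeff_add[of m y "- z"] by (simp add: rflat_coeff_uminus)

lemma rflat_coeff_0 [simp]: "rflat_coeff m 0 = 0"
  using rflat_coeff_diff[of m 0 0] by simp

lemma rflat_coeff_sum: "rflat_coeff m (sum f A) = (\<Sum>x\<in>A. rflat_coeff m (f x))"
  by (induction A rule: infinite_finite_induct) (auto simp: rflat_coeff_add)

lemma rflat_coeff_tensor: "rflat_coeff m (tensor k F) = k * to_fract (graded_lim_coeff F m)"
  unfolding tensor_def by transfer (rule free_coeff_free)

lemma rflat_eqI:
  assumes "\<And>m. rflat_coeff m y = rflat_coeff m z"
  shows "y = z"
proof -
  obtain k F where kF: "y - z = tensor k F" by (rule rflat_cases)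
  have "k * to_fract (graded_lim_coeff F m) = 0" for m
    using assms rflat_coeff_diff[of m y z] by (simp add: kF rflat_coeff_tensor)
  hence "F = 0" if "k \<noteq> 0" using that by (intro graded_lim_eqI) simp
  hence "y - z = 0" using kF by (cases "k = 0") simp_all
  thus ?thesis by simp
qed

lemma rflat_coeff_scalar: "rflat_coeff m (rflat_scalar k) = (k when m = 0)"
  by (simp add: rflat_scalar_def rflat_coeff_tensor graded_lim_coeff_1 when_def)

lemma rflat_piece_iff:
  "y \<in> rflat_piece d \<longleftrightarrow> (\<forall>m. rflat_coeff m y \<noteq> 0 \<longrightarrow> mono_degree m = d)"
proof
  let ?S = "{y. \<forall>m. rflat_coeff m y \<noteq> 0 \<longrightarrow> mono_degree m = d}"
  have "rflat_piece d \<subseteq> ?S"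
    unfolding rflat_piece_def
  proof (rule hull_minimal)
    show "{tensor k F | k F. F \<in> graded_lim_piece d} \<subseteq> ?S"
      by (auto simp: rflat_coeff_tensor graded_lim_piece_iff)
    show "add_subgroup ?S"
      by (auto simp: add_subgroup_def rflat_coeff_add rflat_coeff_uminus) (metis add_0)
  qed
  thus "y \<in> rflat_piece d \<Longrightarrow> \<forall>m. rflat_coeff m y \<noteq> 0 \<longrightarrow> mono_degree m = d" by blast
next
  assume y: "\<forall>m. rflat_coeff m y \<noteq> 0 \<longrightarrow> mono_degree m = d"
  obtain k F where kF: "y = tensor k F" by (rule rflat_cases)
  have "\<exists>k F. y = tensor k F \<and> F \<in> graded_lim_piece d"
  proof (cases "k = 0")
    case True
    thus ?thesis using kF by (intro exI[of _ 0]) (auto simp: graded_lim_piece_iff intro!: exI[of _ 0])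
  next
    case False
    hence "F \<in> graded_lim_piece d"
      using y by (auto simp: kF graded_lim_piece_iff rflat_coeff_tensor)
    thus ?thesis using kF by blast
  qed
  thus "y \<in> rflat_piece d" unfolding rflat_piece_def by (intro hull_inc) auto
qed

lemma rflat_piece_mult:
  assumes "y \<in> rflat_piece i" "z \<in> rflat_piece j"
  shows "y * z \<in> rflat_piece (i + j)"
proof -
  obtain k F l G where y: "y = tensor k F" and z: "z = tensor l G"
    by (metis rflat_cases)
  show ?thesis
  proof (cases "k = 0 \<or> l = 0")
    case True
    thus ?thesis by (auto simp: y z rflat_piece_iff)
  next
    case False
    hence "F \<in> graded_lim_piece i" "G \<in> graded_lim_piece j"
      using assms by (auto simp: y z rflat_piece_iff graded_lim_piece_iff rflat_coeff_tensor)
    from graded_lim_piece_mult[OF this] show ?thesis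
      by (simp add: y z tensor_mult rflat_piece_iff graded_lim_piece_iff rflat_coeff_tensor)
  qed
qed

lemma ring_homomorphism_rflat_scalar:
  "ring_homomorphism (rflat_scalar :: 'a::idom fract \<Rightarrow> ('u, 'a) rflat)"
  by (simp add: ring_homomorphism_def rflat_scalar_def tensor_1_1 tensor_add_left tensor_mult)

lemma rflat_piece_0: "(rflat_piece 0 :: ('u, 'a::idom) rflat set) = range rflat_scalar"
proof (intro equalityI subsetI)
  fix y :: "('u, 'a) rflat" assume y: "y \<in> rflat_piece 0"
  have "y = rflat_scalar (rflat_coeff 0 y)"
    using y mono_degree_eq_0
    by (intro rflat_eqI) (auto simp: rflat_coeff_scalar when_def rflat_piece_iff)
  thus "y \<in> range rflat_scalar" by blast
qed (auto simp: rflat_piece_iff rflat_coeff_scalar when_def split: if_splits)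

lemma exists_rflat_part:
  "\<exists>z. \<forall>m. rflat_coeff m z = (rflat_coeff m y when mono_degree m = d)"
proof -
  obtain k F where kF: "y = tensor k F" by (rule rflat_cases)
  obtain G where "\<And>m. graded_lim_coeff G m = (graded_lim_coeff F m when mono_degree m = d)"
    using exists_graded_lim_part by blast
  hence "\<forall>m. rflat_coeff m (tensor k G) = (rflat_coeff m y when mono_degree m = d)"
    by (simp add: kF rflat_coeff_tensor when_def)
  thus ?thesis by blast
qed

lemma ring_grading_rflat_piece: "ring_grading (rflat_piece :: nat \<Rightarrow> ('u, 'a::idom) rflat set)"
  unfolding ring_grading_def
proof (intro conjI allI ballI)
  show "add_subgroup (rflat_piece d :: ('u, 'a) rflat set)" for d
    unfolding rflat_piece_def by (rule add_subgroup_hull)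
  show "(1 :: ('u, 'a) rflat) \<in> rflat_piece 0"
    using rflat_piece_0 by (auto simp: rflat_scalar_def simp flip: tensor_1_1)
  show "y * z \<in> rflat_piece (i + j)" if "y \<in> rflat_piece i" "z \<in> rflat_piece j"
    for i j and y z :: "('u, 'a) rflat"
    using that by (rule rflat_piece_mult)
  fix y :: "('u, 'a) rflat"
  have "\<exists>f. \<forall>d m. rflat_coeff m (f d) = (rflat_coeff m y when mono_degree m = d)"
    using exists_rflat_part[of y] by (intro choice allI)
  then obtain f where f: "\<And>d m. rflat_coeff m (f d) = (rflat_coeff m y when mono_degree m = d)"
    by blast
  show "\<exists>!f. finite {d. f d \<noteq> 0} \<and> (\<forall>d. f d \<in> rflat_piece d) \<and> y = (\<Sum>d | f d \<noteq> 0. f d)"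
  proof (rule ex1I[of _ f])
    obtain k F where kF: "y = tensor k F" by (rule rflat_cases)
    obtain b where "\<And>m. graded_lim_coeff F m \<noteq> 0 \<Longrightarrow> mono_degree m \<le> b"
      using graded_lim_bounded[of F] by blast
    hence b: "rflat_coeff m y = 0" if "mono_degree m > b" for m
      using that by (auto simp: kF rflat_coeff_tensor not_le[symmetric])
    have "f d = 0" if "d > b" for d
      using that b by (intro rflat_eqI) (auto simp: f when_def)
    hence sub: "{d. f d \<noteq> 0} \<subseteq> {..b}" by (auto simp: not_le[symmetric])
    hence fin: "finite {d. f d \<noteq> 0}" by (rule finite_subset) simp
    have "y = (\<Sum>d\<le>b. f d)"
    proof (rule rflat_eqI)
      fix m
      show "rflat_coeff m y = rflat_coeff m (\<Sum>d\<le>b. f d)"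
        using b[of m] by (simp add: rflat_coeff_sum f when_def not_le)
    qed
    also have "\<dots> = (\<Sum>d | f d \<noteq> 0. f d)"
      using sub by (intro sum.mono_neutral_right) auto
    finally show "finite {d. f d \<noteq> 0} \<and> (\<forall>d. f d \<in> rflat_piece d) \<and> y = (\<Sum>d | f d \<noteq> 0. f d)"
      using fin by (auto simp: rflat_piece_iff f when_def)
  next
    fix g assume g: "finite {d. g d \<noteq> 0} \<and> (\<forall>d. g d \<in> rflat_piece d) \<and> y = (\<Sum>d | g d \<noteq> 0. g d)"
    have "rflat_coeff m (g d) = rflat_coeff m (f d)" for m d
    proof (cases "mono_degree m = d")
      case False
      thus ?thesis using g by (auto simp: f rflat_piece_iff)
    next
      case True
      have "rflat_coeff m y = (\<Sum>e | g e \<noteq> 0. rflat_coeff m (g e))"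
        using g by (metis rflat_coeff_sum)
      also have "\<dots> = (\<Sum>e | g e \<noteq> 0. if e = d then rflat_coeff m (g d) else 0)"
        using g True by (intro sum.cong) (auto simp: rflat_piece_iff)
      also have "\<dots> = rflat_coeff m (g d)"
        using g by simp
      finally show ?thesis using True by (simp add: f)
    qed
    thus "g = f" by (intro ext rflat_eqI)
  qed
qed

text \<open>Specified through coefficients, which makes it independent of the representation \<open>k \<otimes> F\<close>; such
  an element exists because \<open>k \<otimes> hasse_lim i n F\<close> is one.\<close>

definition rflat_hasse :: "'u \<Rightarrow> nat \<Rightarrow> ('u, 'a::idom) rflat \<Rightarrow> ('u, 'a) rflat" where
  "rflat_hasse i n y = (SOME z. \<forall>e. rflat_coeff e z =
     of_nat ((Poly_Mapping.lookup e i + n) choose n) * rflat_coeff (e + Poly_Mapping.single i n) y)"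

lemma to_fract_of_nat: "to_fract (of_nat n) = of_nat n"
  by (simp add: to_fract_def of_nat_fract)

lemma rflat_coeff_tensor_hasse_lim:
  "rflat_coeff e (tensor k (hasse_lim i n F)) =
     of_nat ((Poly_Mapping.lookup e i + n) choose n) *
     rflat_coeff (e + Poly_Mapping.single i n) (tensor k F)"
  by (simp add: rflat_coeff_tensor graded_lim_coeff_hasse_lim to_fract_of_nat mult_ac)

lemma rflat_coeff_hasse:
  "rflat_coeff e (rflat_hasse i n y) =
     of_nat ((Poly_Mapping.lookup e i + n) choose n) * rflat_coeff (e + Poly_Mapping.single i n) y"
proof -
  obtain k F where "y = tensor k F" by (rule rflat_cases)
  hence "\<exists>z. \<forall>e. rflat_coeff e z =
     of_nat ((Poly_Mapping.lookup e i + n) choose n) * rflat_coeff (e + Poly_Mapping.single i n) y"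
    by (intro exI[of _ "tensor k (hasse_lim i n F)"]) (simp add: rflat_coeff_tensor_hasse_lim)
  from someI_ex[OF this] show ?thesis by (simp add: rflat_hasse_def)
qed

lemma rflat_hasse_tensor: "rflat_hasse i n (tensor k F) = tensor k (hasse_lim i n F)"
  by (rule rflat_eqI) (simp add: rflat_coeff_hasse rflat_coeff_tensor_hasse_lim)

lemma tensor_sum_right: "tensor k (sum f A) = (\<Sum>x\<in>A. tensor k (f x))"
  by (induction A rule: infinite_finite_induct) (auto simp: tensor_add_right)

lemma hasse_algebra_rflat:
  "hasse_algebra (rflat_scalar :: 'a::idom fract \<Rightarrow> ('u, 'a) rflat) rflat_piece rflat_hasse"
proof unfold_locales
  fix i :: 'u and n d :: nat and x y :: "('u, 'a) rflat" and c :: "'a fract"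
  show "ring_homomorphism (rflat_scalar :: 'a fract \<Rightarrow> ('u, 'a) rflat)"
    by (rule ring_homomorphism_rflat_scalar)
  show "ring_grading (rflat_piece :: nat \<Rightarrow> ('u, 'a) rflat set)"
    by (rule ring_grading_rflat_piece)
  show "(rflat_piece 0 :: ('u, 'a) rflat set) = range rflat_scalar"
    by (rule rflat_piece_0)
  show "rflat_hasse i 0 x = x"
    by (rule rflat_eqI) (simp add: rflat_coeff_hasse)
  show "rflat_hasse i n (x + y) = rflat_hasse i n x + rflat_hasse i n y"
    by (rule rflat_eqI) (simp add: rflat_coeff_hasse rflat_coeff_add distrib_left)
  show "rflat_hasse i n (x * y) = (\<Sum>j\<le>n. rflat_hasse i j x * rflat_hasse i (n - j) y)"
  proof -
    obtain k F l G where "x = tensor k F" "y = tensor l G" by (metis rflat_cases)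
    thus ?thesis by (simp add: tensor_mult rflat_hasse_tensor hasse_lim_mult tensor_sum_right)
  qed
  show "rflat_hasse i n (rflat_scalar c) = (0 :: ('u, 'a) rflat)" if "n > 0"
  proof (rule rflat_eqI)
    fix e
    have "e + Poly_Mapping.single i n \<noteq> 0"
      using that by (metis add_gr_0 less_irrefl lookup_add lookup_single_eq lookup_zero)
    thus "rflat_coeff e (rflat_hasse i n (rflat_scalar c)) = rflat_coeff e (0 :: ('u, 'a) rflat)"
      by (simp add: rflat_coeff_hasse rflat_coeff_scalar)
  qed
  show "rflat_hasse i n x \<in> rflat_piece (d - n)" if "x \<in> rflat_piece d"
    unfolding rflat_piece_iff
  proof (intro allI impI)
    fix e assume "rflat_coeff e (rflat_hasse i n x) \<noteq> 0"
    hence "mono_degree (e + Poly_Mapping.single i n) = d"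
      using that by (auto simp: rflat_coeff_hasse rflat_piece_iff)
    thus "mono_degree e = d - n" by (auto simp: mono_degree_add mono_degree_single)
  qed
  show "rflat_hasse i n x = 0" if "x \<in> rflat_piece d" "d < n"
  proof (rule rflat_eqI)
    fix e
    have "mono_degree (e + Poly_Mapping.single i n) \<noteq> d"
      using that(2) by (simp add: mono_degree_add mono_degree_single)
    hence "rflat_coeff (e + Poly_Mapping.single i n) x = 0"
      using that(1) by (auto simp: rflat_piece_iff)
    thus "rflat_coeff e (rflat_hasse i n x) = rflat_coeff e 0" by (simp add: rflat_coeff_hasse)
  qed
  \<comment> \<open>If \<open>m\<close> contains \<open>x\<^sub>i\<close> with exponent \<open>n\<close>, then the coefficient of \<open>m / x\<^sub>i\<^sup>n\<close> in \<open>H i n x\<close> is that of \<open>m\<close>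
      in \<open>x\<close>, as the binomial coefficient is \<open>n choose n = 1\<close>.\<close>
  show "x \<in> range rflat_scalar" if H: "\<And>i n. n > 0 \<Longrightarrow> rflat_hasse i n x = 0"
  proof -
    have "mono_degree m = 0" if nz: "rflat_coeff m x \<noteq> 0" for m
    proof (rule ccontr)
      assume "mono_degree m \<noteq> 0"
      hence "m \<noteq> 0" by auto
      then obtain i where i: "Poly_Mapping.lookup m i > 0"
        by (metis gr0I lookup_zero poly_mapping_eqI)
      define e where "e = m - Poly_Mapping.single i (Poly_Mapping.lookup m i)"
      have e: "e + Poly_Mapping.single i (Poly_Mapping.lookup m i) = m" "Poly_Mapping.lookup e i = 0"
        by (auto intro!: poly_mapping_eqI simp: e_def lookup_add lookup_minus lookup_single when_def)
      have "rflat_coeff e (rflat_hasse i (Poly_Mapping.lookup m i) x) = rflat_coeff m x"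
        by (simp add: rflat_coeff_hasse e)
      thus False using H[OF i] nz by simp
    qed
    hence "x \<in> rflat_piece 0" by (simp add: rflat_piece_iff)
    thus ?thesis by (simp add: rflat_piece_0)
  qed
qed

theorem corollary6p11:
  fixes \<iota> :: "'k::field \<Rightarrow> 'a::idom" and T :: "'a set"
  assumes "semi_perfect TYPE('k)"
    and "polynomial_ring_over \<iota> T"
    and "infinite (UNIV :: 'u set)"
  shows "polynomial_graded_algebra
           (rflat_scalar :: 'a fract \<Rightarrow> ('u, 'a) rflat) (rflat_piece :: nat \<Rightarrow> ('u, 'a) rflat set)"
  by (rule hasse_algebra.polynomial_if_enough_hasse[OF hasse_algebra_rflat])

end
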